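(* For each $n \in \mathbb{N}$, $n\ge 2$, let $p = p(n) \in [0,1]$, let $\mathbb{P} = \mathbb{P}_n$ be the law of $\mathbb{G}(n,p)$ with a planted uniformly random spanning tree of $K_n$, and let $\mathbb{Q} = \mathbb{Q}_n = \mathbb{G}(n,q)$ with $q = p + \frac{2(1-p)}{n}$. Then \[ \lim_{n \to \infty} \mathrm{d}_{\mathrm{TV}}(\mathbb{P},\mathbb{Q}) = \begin{cases} 0 & \text{when } p = \omega(n^{-1/2}),\\ 1 & \text{when } p = o(n^{-1/2}). \end{cases} \]
   Context: All graphs are simple labelled graphs on the vertex set $[n]=\{1,\dots,n\}$, and $K_n$ is the complete graph on $[n]$. $\mathbb{G}(n,a)$ denotes the law of the Erdős–Rényi random graph on $[n]$, in which each of the $\binom{n}{2}$ possible edges is present independently with probability $a$. Planted distribution: $\mathbb{P}$ is the law of the simple graph whose edge set is $E(\mathbf{G}_0)\cup E(\mathbf{H})$, where $\mathbf{G}_0 \sim \mathbb{G}(n,p)$ and $\mathbf{H}$ is independent of $\mathbf{G}_0$ and uniformly distributed over all spanning trees of $K_n$ (each having $n-1$ edges). The value of $q$ is such that the expected numbers of edges under $\mathbb{P}$ and $\mathbb{Q}$ coincide. $\mathrm{d}_{\mathrm{TV}}(\mathbb{P},\mathbb{Q}) = \frac12\sum_G |\mathbb{P}(G)-\mathbb{Q}(G)|$ is the total variation distance, the sum being over all graphs $G$ on $[n]$. The edge probability $p$ may depend on $n$; $p = \omega(n^{-1/2})$ means $p\, n^{1/2}\to\infty$, and $p = o(n^{-1/2})$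 means $p\, n^{1/2}\to 0$, as $n\to\infty$. *)

theory Defs
  imports "HOL-Probability.Probability"
begin

text \<open>
  A simple graph on the vertex set \<open>{1..n}\<close> is identified with its edge set,
  so the graphs on \<open>{1..n}\<close> are the subsets of \<open>complete_edges n\<close>, the edge set of \<open>K\<^sub>n\<close>.
\<close>

definition complete_edges :: "nat \<Rightarrow> nat set set" where
  "complete_edges n = {e. e \<subseteq> {1..n} \<and> card e = 2}"

definition graphs_on :: "nat \<Rightarrow> nat set set set" where
  "graphs_on n = Pow (complete_edges n)"

definition graph_connected :: "'a set \<Rightarrow> 'a set set \<Rightarrow> bool" where
  "graph_connected V E \<longleftrightarrow>
     V \<noteq> {} \<and> (\<forall>u\<in>V. \<forall>v\<in>V. (u, v) \<in> {(x, y). {x, y} \<in> E}\<^sup>*)"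

text \<open>
  A cycle is given by its list of pairwise distinct vertices, at least three of them;
  the index is taken modulo the length so that the closing edge is included.
\<close>

definition graph_cycle :: "'a set set \<Rightarrow> 'a list \<Rightarrow> bool" where
  "graph_cycle E xs \<longleftrightarrow>
     length xs \<ge> 3 \<and> distinct xs \<and>
     (\<forall>i<length xs. {xs ! i, xs ! (Suc i mod length xs)} \<in> E)"

definition spanning_trees :: "nat \<Rightarrow> nat set set set" where
  "spanning_trees n =
     {T \<in> graphs_on n. graph_connected {1..n} T \<and> (\<nexists>xs. graph_cycle T xs)}"

text \<open>
  The edge indicators are independent Bernoulli variables. Note that \<open>bernoulli_pmf\<close>
  is meaningful only for a parameter in \<open>[0, 1]\<close>.
\<close>

definition erdos_renyi :: "nat \<Rightarrow> real \<Rightarrow> nat set set pmf" where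
  "erdos_renyi n a =
     map_pmf (\<lambda>f. {e \<in> complete_edges n. f e})
       (Pi_pmf (complete_edges n) False (\<lambda>_. bernoulli_pmf a))"

definition planted_tree :: "nat \<Rightarrow> real \<Rightarrow> nat set set pmf" where
  "planted_tree n p =
     map_pmf (\<lambda>(G\<^sub>0, H). G\<^sub>0 \<union> H)
       (pair_pmf (erdos_renyi n p) (pmf_of_set (spanning_trees n)))"

definition tv_dist :: "nat \<Rightarrow> nat set set pmf \<Rightarrow> nat set set pmf \<Rightarrow> real" where
  "tv_dist n P Q = (\<Sum>G\<in>graphs_on n. \<bar>pmf P G - pmf Q G\<bar>) / 2"

text \<open>
  For \<open>n \<ge> 1\<close> the set of spanning trees is finite and nonempty, so that the
  uniform distribution on it is well-defined.
\<close>

lemma finite_complete_edges: "finite (complete_edges n)"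
  by (rule finite_subset[of _ "Pow {1..n}"]) (auto simp: complete_edges_def)

lemma finite_spanning_trees: "finite (spanning_trees n)"
  by (rule finite_subset[of _ "Pow (complete_edges n)"])
    (auto simp: spanning_trees_def graphs_on_def finite_complete_edges)

lemma spanning_trees_nonempty:
  assumes "n \<ge> 1"
  shows "spanning_trees n \<noteq> {}"
proof -
  define T where "T = {e \<in> complete_edges n. 1 \<in> e}"
  define R where "R = {(x, y). {x, y} \<in> T}"
  have star: "(1, v) \<in> R\<^sup>* \<and> (v, 1) \<in> R\<^sup>*" if "v \<in> {1..n}" for v
  proof (cases "v = 1")
    case False
    with that have "{1, v} \<in> T"
      by (auto simp: T_def complete_edges_def)
    then show ?thesis
      by (auto simp: R_def insert_commute)
  qed auto
  have "(u, v) \<in> R\<^sup>*" if "u \<in> {1..n}" "v \<in> {1..n}" for u v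
    using rtrancl_trans[of u 1 R v] star[OF that(1)] star[OF that(2)] by blast
  then have "graph_connected {1..n} T"
    unfolding graph_connected_def R_def[symmetric] using assms by simp
  moreover have False if "graph_cycle T xs" for xs
  proof -
    let ?k = "length xs"
    have k: "?k \<ge> 3" and d: "distinct xs"
      and e: "\<And>i. i < ?k \<Longrightarrow> xs ! i = 1 \<or> xs ! (Suc i mod ?k) = 1"
      using that by (auto simp: graph_cycle_def T_def)
    have u: "i = j" if "xs ! i = 1" "xs ! j = 1" "i < ?k" "j < ?k" for i j
      using nth_eq_iff_index_eq[OF d that(3,4)] that(1,2) by simp
    have b: "0 < ?k" "1 < ?k" "2 < ?k"
      using k by linarith+
    then have c: "Suc 0 mod ?k = 1" "Suc 1 mod ?k = 2"
      by simp_all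
    have m: "Suc 2 mod ?k \<noteq> 1" "Suc 2 mod ?k < ?k"
      using k by (cases "?k = 3"; simp)+
    have "xs ! 0 = 1 \<or> xs ! 1 = 1" "xs ! 1 = 1 \<or> xs ! 2 = 1"
      using e[OF b(1)] e[OF b(2)] unfolding c .
    moreover have "\<not> (xs ! 0 = 1 \<and> xs ! 2 = 1)"
      using u[OF _ _ b(1,3)] by fastforce
    ultimately have one: "xs ! 1 = 1"
      by blast
    have "xs ! 2 \<noteq> 1"
      using u[OF one _ b(2,3)] by fastforce
    moreover have "xs ! (Suc 2 mod ?k) \<noteq> 1"
      using u[OF one _ b(2) m(2)] m(1) by metis
    ultimately show False
      using e[OF b(3)] by blast
  qed
  moreover have "T \<in> graphs_on n"
    by (auto simp: T_def graphs_on_def)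
  ultimately show ?thesis
    by (auto simp: spanning_trees_def)
qed

end

theory Submission
  imports Defs
begin

text \<open>
  Write \<open>N(F)\<close> for the number of spanning trees of \<open>K\<^sub>n\<close> containing \<open>F\<close>. If \<open>x\<close> and \<open>y\<close> lie in distinct
  components of \<open>F\<close>, of sizes \<open>a\<close> and \<open>b\<close>, then \<open>n a b N(F + xy) = (a + b) N(F)\<close>. Hence a uniform
  spanning tree contains \<open>F\<close> with probability at most \<open>(2/n)\<close> to the power \<open>|F|\<close>, and two edges that
  share a vertex with probability exactly \<open>3/n\<^sup>2\<close>, instead of the \<open>4/n\<^sup>2\<close> of independent edges.

  For \<open>p \<gg> n\<close> to the \<open>-1/2\<close>, the second moment of the likelihood ratio is a multiple of the mean of
  \<open>x\<close> to the power \<open>|H \<inter> H'|\<close> for independent trees \<open>H, H'\<close> and an \<open>x \<ge> 1\<close>; by the first bound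
  it is at most \<open>exp (28 / (n p\<^sup>2))\<close>, and Cauchy-Schwarz gives the claim.

  For \<open>p \<ll> n\<close> to the \<open>-1/2\<close>, sum the products of centred edge indicators over all pairs of adjacent
  edges. This statistic has mean \<open>0\<close> under the null model but about \<open>-n\<close> under the planted one,
  because of the deficit \<open>3 < 4\<close> above, and both variances are \<open>o(n\<^sup>2)\<close>.
\<close>

subsection \<open>Spanning trees\<close>

text \<open>For the recursion, delete \<open>xy\<close> from a tree containing
  \<open>F + xy\<close>: the two sides have sizes adding up to n. Weighted by the size of the side
  of \<open>x\<close>, and taken b times, once for each possible end of the edge in the component of
  \<open>y\<close>, such trees correspond one to one to the trees containing F. Only ratios of tree
  counts occur, starting from the empty F.

  In the dense regime the exponent of the second moment is a sum of terms of order 1/p, which need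
  not stay bounded. They cancel because q matches the expected number of edges, and only order 1/(n
  p^2) survives. So the factor of every edge has to be kept sharp to first order; the fact that all
  trees have n - 1 edges makes most of it deterministic, and only the number of shared edges is
  estimated.

  In the sparse regime the edge count has the same mean under both laws, so wedges are the natural
  next statistic: about n^3 ordered pairs, each with mean (1-p)^2 (3 - 4)/n^2, give -n. The null
  variance is of order n^3 q^2, hence o(n^2) when n p^2 tends to 0. Under the planted law the tree
  contributes wedge noise of its own; it stays O(n) because vertex-disjoint wedges are exactly
  uncorrelated.\<close>

definition linked :: "'a set set \<Rightarrow> 'a \<Rightarrow> 'a \<Rightarrow> bool" where
  "linked E u v \<longleftrightarrow> (u, v) \<in> {(x, y). {x, y} \<in> E}\<^sup>*"

lemma linked_refl [simp]: "linked E u u"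
  by (simp add: linked_def)

lemma linked_trans: "linked E u v \<Longrightarrow> linked E v w \<Longrightarrow> linked E u w"
  by (simp add: linked_def)

lemma linked_edge: "{u, v} \<in> E \<Longrightarrow> linked E u v"
  by (auto simp: linked_def)

lemma linked_sym: "linked E u v \<Longrightarrow> linked E v u"
proof -
  have "sym ({(x, y). {x, y} \<in> E}\<^sup>*)"
    by (intro sym_rtrancl) (auto simp: sym_def insert_commute)
  then show "linked E u v \<Longrightarrow> linked E v u"
    by (auto simp: linked_def sym_def)
qed

lemma linked_commute: "linked E u v \<longleftrightarrow> linked E v u"
  using linked_sym by metis

lemma linked_mono: "linked E u v \<Longrightarrow> E \<subseteq> E' \<Longrightarrow> linked E' u v"
  unfolding linked_def by (erule rtrancl_mono[THEN subsetD, rotated]) auto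

lemma linked_empty [simp]: "linked {} u v \<longleftrightarrow> u = v"
  by (simp add: linked_def)

text \<open>A path need cross the new edge at most once, in one of its two directions. Later
  arguments on adding, deleting or exchanging an edge are reduced to this equivalence and then
  closed by transitivity and symmetry.\<close>

lemma linked_insert:
  "linked (insert {s, t} E) a b \<longleftrightarrow>
     linked E a b \<or> linked E a s \<and> linked E t b \<or> linked E a t \<and> linked E s b"
    (is "?L \<longleftrightarrow> ?R a b")
proof
  assume ?L
  then have "(a, b) \<in> {(x, y). {x, y} \<in> insert {s, t} E}\<^sup>*"
    by (simp add: linked_def)
  then show "?R a b"
  proof (induction rule: rtrancl_induct)
    case (step y z)
    have "linked E y z \<or> y = s \<and> z = t \<or> y = t \<and> z = s"
      using step.hyps(2) by (auto simp: doubleton_eq_iff intro: linked_edge)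
    then show ?case
      using step.IH by (meson linked_trans linked_sym linked_refl)
  qed simp
next
  have *: "linked (insert {s, t} E) s t" "linked (insert {s, t} E) t s"
    by (auto intro!: linked_edge simp: insert_commute)
  have m: "linked E u v \<Longrightarrow> linked (insert {s, t} E) u v" for u v
    by (erule linked_mono) auto
  assume "?R a b"
  then show ?L
    using * m by (meson linked_trans)
qed

lemma graph_connected_linked:
  "graph_connected V E \<longleftrightarrow> V \<noteq> {} \<and> (\<forall>u\<in>V. \<forall>v\<in>V. linked E u v)"
  by (simp add: graph_connected_def linked_def)

text \<open>A \<open>graph_cycle\<close> has distinct vertices, so walks must be cut down to paths:
  when the vertex put in front already occurs, the part before its occurrence is dropped.\<close>

lemma linked_path:
  assumes "linked E x y"
  shows "\<exists>xs. xs \<noteq> [] \<and> hd xs = x \<and> last xs = y \<and> distinct xs \<and>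
           successively (\<lambda>u v. {u, v} \<in> E) xs"
proof -
  from assms have "(x, y) \<in> {(x, y). {x, y} \<in> E}\<^sup>*"
    by (simp add: linked_def)
  then show ?thesis
  proof (induction rule: converse_rtrancl_induct)
    case base
    show ?case
      by (rule exI[of _ "[y]"]) simp
  next
    case (step x z)
    then obtain xs where xs: "xs \<noteq> []" "hd xs = z" "last xs = y" "distinct xs"
        "successively (\<lambda>u v. {u, v} \<in> E) xs"
      by blast
    show ?case
    proof (cases "x \<in> set xs")
      case True
      then obtain ys zs where "xs = ys @ x # zs"
        by (auto dest: split_list)
      with xs show ?thesis
        by (intro exI[of _ "x # zs"]) (auto simp: successively_append_iff)
    next
      case False
      with xs step.hyps(1) show ?thesis
        by (intro exI[of _ "x # xs"]) (auto simp: successively_Cons)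
    qed
  qed
qed

lemma successively_linked:
  "successively (\<lambda>u v. {u, v} \<in> E) xs \<Longrightarrow> xs \<noteq> [] \<Longrightarrow> linked E (hd xs) (last xs)"
proof (induction xs)
  case (Cons a xs)
  then show ?case
    by (cases "xs = []") (auto simp: successively_Cons intro: linked_trans[OF linked_edge])
qed simp

text \<open>Acyclicity expressed as "every edge is a bridge". In this form it speaks of
  \<open>linked\<close> only and no list of vertices has to be handled after
  \<open>acyclic_iff_bridged\<close>.\<close>

definition bridged :: "'a set set \<Rightarrow> bool" where
  "bridged E \<longleftrightarrow> (\<forall>x y. {x, y} \<in> E \<longrightarrow> \<not> linked (E - {{x, y}}) x y)"

text \<open>A cycle is an edge together with a path between its ends that avoids it.\<close>

lemma acyclic_iff_bridged:
  assumes "\<And>e. e \<in> E \<Longrightarrow> card e = 2"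
  shows "(\<nexists>xs. graph_cycle E xs) \<longleftrightarrow> bridged E"
proof
  assume acyc: "\<nexists>xs. graph_cycle E xs"
  show "bridged E"
    unfolding bridged_def
  proof (intro allI impI notI)
    fix x y assume e: "{x, y} \<in> E" and l: "linked (E - {{x, y}}) x y"
    have "x \<noteq> y"
      using assms[OF e] by auto
    from linked_path[OF l] obtain xs where xs: "xs \<noteq> []" "hd xs = x" "last xs = y"
        "distinct xs" "successively (\<lambda>u v. {u, v} \<in> E - {{x, y}}) xs"
      by blast
    \<comment> \<open>A path on two vertices would be the edge \<open>{x, y}\<close> itself, which
      has been removed.\<close>
    have "length xs \<ge> 3"
    proof (rule ccontr)
      assume "\<not> length xs \<ge> 3"
      then have "length xs = 0 \<or> length xs = 1 \<or> length xs = 2"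
        by linarith
      with xs \<open>x \<noteq> y\<close> show False
        by (auto simp: length_Suc_conv numeral_2_eq_2)
    qed
    moreover have "{xs ! i, xs ! (Suc i mod length xs)} \<in> E" if "i < length xs" for i
    proof (cases "Suc i < length xs")
      case True
      then show ?thesis
        using xs(5) by (auto simp: successively_conv_nth)
    next
      case False
      with that have "i = length xs - 1" "Suc i = length xs" by auto
      then have "xs ! i = y" "xs ! (Suc i mod length xs) = x"
        using xs(1-3) by (auto simp: last_conv_nth hd_conv_nth)
      then show ?thesis
        using e by (simp add: insert_commute)
    qed
    ultimately have "graph_cycle E xs"
      using xs(4) by (auto simp: graph_cycle_def)
    with acyc show False by blast
  qed
next
  assume br: "bridged E"
  show "\<nexists>xs. graph_cycle E xs"
  proof
    assume "\<exists>xs. graph_cycle E xs"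
    then obtain xs where len: "length xs \<ge> 3" and d: "distinct xs"
      and c: "\<And>i. i < length xs \<Longrightarrow> {xs ! i, xs ! (Suc i mod length xs)} \<in> E"
      by (auto simp: graph_cycle_def)
    have ne: "xs \<noteq> []" using len by auto
    let ?e = "{hd xs, last xs}"
    have "?e \<in> E"
      using c[of "length xs - 1"] len ne
      by (auto simp: last_conv_nth hd_conv_nth insert_commute)
    moreover have "successively (\<lambda>u v. {u, v} \<in> E - {?e}) xs"
      unfolding successively_conv_nth
    proof (intro allI impI)
      fix i assume i: "Suc i < length xs"
      then have "{xs ! i, xs ! Suc i} \<in> E"
        using c[of i] by simp
      \<comment> \<open>The first and the last vertex are not consecutive in the list, since it has
        at least three entries.\<close>
      moreover have "{xs ! i, xs ! Suc i} \<noteq> ?e"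
      proof
        assume "{xs ! i, xs ! Suc i} = ?e"
        then have "xs ! i = xs ! 0 \<and> xs ! Suc i = xs ! (length xs - 1) \<or>
          xs ! i = xs ! (length xs - 1) \<and> xs ! Suc i = xs ! 0"
          using ne by (simp add: doubleton_eq_iff hd_conv_nth last_conv_nth)
        moreover have "0 < length xs" "length xs - 1 < length xs" "i < length xs"
          using len i by linarith+
        ultimately show False
          using i len d by (auto simp: nth_eq_iff_index_eq)
      qed
      ultimately show "{xs ! i, xs ! Suc i} \<in> E - {?e}"
        by simp
    qed
    then have "linked (E - {?e}) (hd xs) (last xs)"
      using ne by (rule successively_linked)
    ultimately show False
      using br by (auto simp: bridged_def)
  qed
qed

section \<open>Components, edge counts and the characterisation of trees\<close>

lemma bridged_subset: "bridged E \<Longrightarrow> F \<subseteq> E \<Longrightarrow> bridged F"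
  unfolding bridged_def by (meson Diff_mono linked_mono order_refl subsetD)

text \<open>The function \<open>r\<close> labels components, so its image counts them without
  forming a quotient. Each new edge merges at most two components, and exactly two when it is a
  bridge.\<close>

lemma component_representatives:
  fixes V :: "'a set"
  assumes "finite V" "finite E" "\<And>e. e \<in> E \<Longrightarrow> e \<subseteq> V \<and> card e = 2"
  shows "\<exists>r :: 'a \<Rightarrow> 'a. (\<forall>u\<in>V. \<forall>v\<in>V. r u = r v \<longleftrightarrow> linked E u v) \<and>
           card V \<le> card (r ` V) + card E \<and>
           (bridged E \<longrightarrow> card V = card (r ` V) + card E)"
  using assms(2,3)
proof (induction E rule: finite_induct)
  case empty
  show ?case by (rule exI[of _ id]) auto
next
  case (insert e E)
  have "\<exists>r :: 'a \<Rightarrow> 'a. (\<forall>u\<in>V. \<forall>v\<in>V. r u = r v \<longleftrightarrow> linked E u v) \<and>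
      card V \<le> card (r ` V) + card E \<and> (bridged E \<longrightarrow> card V = card (r ` V) + card E)"
    by (rule insert.IH) (use insert.prems in blast)
  then obtain r :: "'a \<Rightarrow> 'a" where r: "\<And>u v. u \<in> V \<Longrightarrow> v \<in> V \<Longrightarrow> r u = r v \<longleftrightarrow> linked E u v"
      "card V \<le> card (r ` V) + card E" "bridged E \<Longrightarrow> card V = card (r ` V) + card E"
    by (elim exE conjE) blast
  obtain x y where e: "e = {x, y}" "x \<noteq> y" "x \<in> V" "y \<in> V"
    using insert.prems[of e] by (auto simp: card_2_iff)
  have cE: "card (insert e E) = Suc (card E)"
    using insert.hyps by simp
  \<comment> \<open>The class of \<open>y\<close> takes over the label of \<open>x\<close>; if the
    labels agree already, nothing changes.\<close>
  define r' where "r' = (\<lambda>u. if r u = r y then r x else r u)"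
  have r': "r' u = r' v \<longleftrightarrow> linked (insert e E) u v" if "u \<in> V" "v \<in> V" for u v
  proof -
    have "linked E u v \<longleftrightarrow> r u = r v" "linked E u x \<longleftrightarrow> r u = r x" "linked E y v \<longleftrightarrow> r y = r v"
      "linked E u y \<longleftrightarrow> r u = r y" "linked E x v \<longleftrightarrow> r x = r v"
      using that e(3,4) r(1) by simp_all
    then show ?thesis
      unfolding e(1) linked_insert r'_def by (simp split: if_split)
  qed
  have img: "r' ` V = (if r x = r y then r ` V else r ` V - {r y})"
  proof (cases "r x = r y")
    case True
    then have "r' = r" by (auto simp: r'_def)
    with True show ?thesis by simp
  next
    case False
    have "r' ` V \<subseteq> r ` V - {r y}"
      using False e(3) by (auto simp: r'_def)
    moreover have "r u \<in> r' ` V" if "u \<in> V" "r u \<noteq> r y" for u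
      using that by (intro image_eqI[of _ _ u]) (auto simp: r'_def)
    ultimately show ?thesis
      using False by auto
  qed
  have "card (r ` V) \<le> Suc (card (r' ` V))"
    using assms(1) by (auto simp: img card_Diff_singleton_if)
  moreover have "card (r ` V) = Suc (card (r' ` V))" if "bridged (insert e E)"
  proof -
    have "insert e E - {{x, y}} = E"
      using insert.hyps(2) e(1) by auto
    with that e(1) have "\<not> linked E x y"
      unfolding bridged_def by (metis insertI1)
    then have "r x \<noteq> r y"
      using r(1)[OF e(3,4)] by blast
    then show ?thesis
      using card.remove[of "r ` V" "r y"] assms(1) e(4) by (simp add: img)
  qed
  moreover have "bridged E" if "bridged (insert e E)"
    using that by (rule bridged_subset) auto
  ultimately have "card V \<le> card (r' ` V) + card (insert e E)"
      "bridged (insert e E) \<longrightarrow> card V = card (r' ` V) + card (insert e E)"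
    using r(2,3) unfolding cE by linarith+
  then show ?case
    using r' by (intro exI[of _ r'] conjI ballI impI) blast+
qed

definition tree_on :: "'a set \<Rightarrow> 'a set set \<Rightarrow> bool" where
  "tree_on V T \<longleftrightarrow> (\<forall>e\<in>T. e \<subseteq> V \<and> card e = 2) \<and> graph_connected V T \<and> bridged T"

text \<open>With a single component, the component count gives at least \<open>card V - 1\<close>
  edges, with equality for a bridged graph. Conversely, an edge that is no bridge could be deleted
  without losing connectivity, leaving too few edges. The criterion suits exchanges, which visibly
  preserve the number of edges.\<close>

lemma tree_on_iff_card:
  assumes "finite V" "V \<noteq> {}"
  shows "tree_on V T \<longleftrightarrow>
    (\<forall>e\<in>T. e \<subseteq> V \<and> card e = 2) \<and> graph_connected V T \<and> card T = card V - 1"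
proof -
  {
    assume e: "\<forall>e\<in>T. e \<subseteq> V \<and> card e = 2" and c: "graph_connected V T"
    have *: "card V - 1 \<le> card E \<and> (bridged E \<longrightarrow> card E = card V - 1)"
      if E: "E \<subseteq> T" "graph_connected V E" for E
    proof -
      have "finite E"
        using assms(1) e E(1) by (intro finite_subset[of E "Pow V"]) auto
      from assms(1) this have "\<exists>r :: 'a \<Rightarrow> 'a. (\<forall>u\<in>V. \<forall>v\<in>V. r u = r v \<longleftrightarrow> linked E u v) \<and>
          card V \<le> card (r ` V) + card E \<and> (bridged E \<longrightarrow> card V = card (r ` V) + card E)"
        by (rule component_representatives) (use e E(1) in blast)
      then obtain r :: "'a \<Rightarrow> 'a" where r: "\<And>u v. u \<in> V \<Longrightarrow> v \<in> V \<Longrightarrow> r u = r v \<longleftrightarrow> linked E u v"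
          "card V \<le> card (r ` V) + card E"
          "bridged E \<longrightarrow> card V = card (r ` V) + card E"
        by (elim exE conjE) blast
      obtain w where w: "w \<in> V" using assms(2) by blast
      have "r u = r w" if "u \<in> V" for u
        using r(1)[OF that w] E(2) that w unfolding graph_connected_linked by blast
      then have "r ` V = {r w}"
        using w by blast
      then show ?thesis
        using r(2,3) by simp
    qed
    have "bridged T" if ct: "card T = card V - 1"
      unfolding bridged_def
    proof (intro allI impI notI)
      fix x y assume xy: "{x, y} \<in> T" "linked (T - {{x, y}}) x y"
      have "linked (T - {{x, y}}) u v" if "linked T u v" for u v
      proof -
        have "linked (insert {x, y} (T - {{x, y}})) u v"
          using that xy(1) by (simp add: insert_absorb)
        then show ?thesis
          using xy(2) unfolding linked_insert by (meson linked_trans linked_sym)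
      qed
      then have "graph_connected V (T - {{x, y}})"
        using c by (auto simp: graph_connected_linked)
      then have "card V - 1 \<le> card (T - {{x, y}})"
        using *[of "T - {{x, y}}"] by blast
      moreover have "finite T"
        using assms(1) e by (intro finite_subset[of T "Pow V"]) auto
      ultimately show False
        using card.remove[of T "{x, y}"] xy(1) ct by simp
    qed
    then have "bridged T \<longleftrightarrow> card T = card V - 1"
      using *[OF order_refl c] by blast
  }
  then show ?thesis
    unfolding tree_on_def by blast
qed

lemma spanning_trees_iff: "T \<in> spanning_trees n \<longleftrightarrow> tree_on {1..n} T"
  using acyclic_iff_bridged[of T]
  by (auto simp: spanning_trees_def tree_on_def graphs_on_def complete_edges_def)

subsection \<open>Trees containing a given edge set\<close>

definition trees_containing :: "nat \<Rightarrow> nat set set \<Rightarrow> nat set set set" where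
  "trees_containing n F = {T \<in> spanning_trees n. F \<subseteq> T}"

lemma finite_trees_containing [simp]: "finite (trees_containing n F)"
  unfolding trees_containing_def by (rule finite_subset[OF _ finite_spanning_trees]) auto

lemma spanning_treeD:
  assumes "T \<in> spanning_trees n"
  shows "T \<subseteq> complete_edges n" "u \<in> {1..n} \<Longrightarrow> v \<in> {1..n} \<Longrightarrow> linked T u v"
    "{x, y} \<in> T \<Longrightarrow> \<not> linked (T - {{x, y}}) x y"
  using assms unfolding spanning_trees_iff tree_on_def bridged_def graph_connected_linked
  by (auto simp: complete_edges_def)

lemma card_spanning_tree:
  assumes "T \<in> spanning_trees n"
  shows "card T = n - 1"
proof -
  have "{1..n} \<noteq> {}"
    using assms unfolding spanning_trees_iff tree_on_def graph_connected_linked by blast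
  then show ?thesis
    using assms tree_on_iff_card[of "{1..n}" T] by (simp add: spanning_trees_iff)
qed

lemma spanning_treeI:
  assumes "n \<ge> 1" "T \<subseteq> complete_edges n" "\<And>u v. u \<in> {1..n} \<Longrightarrow> v \<in> {1..n} \<Longrightarrow> linked T u v"
    "card T = n - 1"
  shows "T \<in> spanning_trees n"
proof -
  have "{1..n} \<noteq> {}" using assms(1) by simp
  then show ?thesis
    unfolding spanning_trees_iff
    by (subst tree_on_iff_card)
      (use assms in \<open>auto simp: graph_connected_linked complete_edges_def\<close>)
qed

text \<open>Deleting \<open>{x, y}\<close> separates \<open>x\<close> from \<open>y\<close>, and any
  edge between the two sides reconnects them with the edge count unchanged. The second conclusion
  makes the exchange reversible: deleting \<open>{u, v}\<close> gives back exactly the forest that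
  was left.\<close>

lemma tree_swap:
  assumes T: "T \<in> spanning_trees n" "{x, y} \<in> T"
    and uv: "u \<in> {1..n}" "v \<in> {1..n}"
    and l: "linked (T - {{x, y}}) x u" "linked (T - {{x, y}}) y v"
  shows "insert {u, v} (T - {{x, y}}) \<in> spanning_trees n" "{u, v} \<notin> T - {{x, y}}"
proof -
  define T0 where "T0 = T - {{x, y}}"
  note T0_def[symmetric, simp]
  have T0: "T = insert {x, y} T0" "{x, y} \<notin> T0"
    using T(2) by (auto simp del: T0_def[symmetric] simp: T0_def)
  have l': "linked T0 x u" "linked T0 y v"
    using l by auto
  have "\<not> linked T0 x y"
    using spanning_treeD(3)[OF T] by simp
  then have nuv: "\<not> linked T0 u v"
    using l' by (meson linked_trans linked_sym)
  then have ne: "u \<noteq> v" and notin: "{u, v} \<notin> T0"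
    by (auto dest: linked_edge)
  from notin show "{u, v} \<notin> T - {{x, y}}" by simp
  have fin: "finite T0"
    using spanning_treeD(1)[OF T(1)] finite_complete_edges T0(1)
    by (meson finite_subset finite_insert)
  have "linked (insert {u, v} T0) a b" if ab: "linked T a b" for a b
  proof -
    have m: "linked T0 c d \<Longrightarrow> linked (insert {u, v} T0) c d" for c d
      by (erule linked_mono) auto
    have "linked (insert {u, v} T0) u v"
      by (auto intro: linked_edge)
    then have xy: "linked (insert {u, v} T0) x y"
      using m l' by (meson linked_trans linked_sym)
    show ?thesis
      using ab unfolding T0(1) linked_insert[of x y]
      using xy m by (meson linked_trans linked_sym)
  qed
  then have "insert {u, v} T0 \<in> spanning_trees n"
    using card_spanning_tree[OF T(1)] spanning_treeD(1,2)[OF T(1)] uv T0 ne notin fin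
    by (intro spanning_treeI) (auto simp: complete_edges_def)
  then show "insert {u, v} (T - {{x, y}}) \<in> spanning_trees n" by simp
qed

definition side :: "nat \<Rightarrow> nat set set \<Rightarrow> nat \<Rightarrow> nat \<Rightarrow> nat set" where
  "side n T x y = {v \<in> {1..n}. linked (T - {{x, y}}) x v}"

text \<open>A tree minus an edge has exactly two components. This is the source of the factor n in
  the recursion.\<close>

lemma card_sides:
  assumes "T \<in> spanning_trees n" "{x, y} \<in> T"
  shows "card (side n T x y) + card (side n T y x) = n"
proof -
  have e: "{y, x} = {x, y}" by auto
  have xy: "x \<in> {1..n}" "y \<in> {1..n}"
    using spanning_treeD(1)[OF assms(1)] assms(2) by (auto simp: complete_edges_def)
  have "side n T x y \<inter> side n T y x = {}"
    using spanning_treeD(3)[OF assms] unfolding side_def e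
    by (auto dest: linked_sym linked_trans)
  moreover have "side n T x y \<union> side n T y x = {1..n}"
  proof -
    have "linked (insert {x, y} (T - {{x, y}})) x v" if "v \<in> {1..n}" for v
      using spanning_treeD(2)[OF assms(1) xy(1) that] assms(2) by (simp add: insert_absorb)
    then show ?thesis
      unfolding side_def e linked_insert by fastforce
  qed
  moreover have "finite (side n T x y)" "finite (side n T y x)"
    by (simp_all add: side_def)
  ultimately show ?thesis
    by (metis card_Un_disjoint card_atLeastAtMost diff_Suc_1)
qed

definition comp_of :: "nat \<Rightarrow> nat set set \<Rightarrow> nat \<Rightarrow> nat set" where
  "comp_of n F x = {v \<in> {1..n}. linked F x v}"

text \<open>Take the last exit from \<open>B\<close> on a walk to \<open>x\<close>. Afterwards the
  walk uses only edges of \<open>A\<close>, which avoid \<open>B\<close>, and so never the exit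
  edge, which has an end in \<open>B\<close>.\<close>

lemma linked_exit:
  assumes "linked T y x" "y \<in> B" "x \<notin> B"
  shows "\<exists>y'\<in>B. \<exists>v. v \<notin> B \<and> {y', v} \<in> T \<and> linked (T - {{y', v}}) v x"
proof -
  define A where "A = {e \<in> T. e \<inter> B = {}}"
  from assms(1) have "(y, x) \<in> {(x, y). {x, y} \<in> T}\<^sup>*"
    by (simp add: linked_def)
  then have "(y \<notin> B \<and> linked A y x) \<or> (\<exists>y'\<in>B. \<exists>v. v \<notin> B \<and> {y', v} \<in> T \<and> linked A v x)"
  proof (induction rule: converse_rtrancl_induct)
    case (step y z)
    have "linked A y z" if "y \<notin> B" "z \<notin> B"
      using step.hyps(1) that by (intro linked_edge) (auto simp: A_def)
    then show ?case
      using step.IH step.hyps(1) by (cases "y \<in> B") (auto intro: linked_trans)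
  qed (use assms(3) in auto)
  moreover have "linked (T - {{y', v}}) v x" if "linked A v x" "y' \<in> B" for y' v
    using that(1) by (rule linked_mono) (use that(2) in \<open>auto simp: A_def\<close>)
  ultimately show ?thesis
    using assms(2) by blast
qed

text \<open>
  Re-attaching the far end of the edge \<open>{x, y'}\<close> at a vertex \<open>v\<close> on the side of \<open>x\<close> loses no
  information: \<open>{v, y'}\<close> is the edge by which the path towards \<open>x\<close> leaves the component of \<open>y\<close>.
\<close>

lemma sum_card_sides:
  assumes F: "F \<subseteq> complete_edges n" and xy: "x \<in> {1..n}" "y \<in> {1..n}" "\<not> linked F x y"
  shows "(\<Sum>y'\<in>comp_of n F y. \<Sum>T\<in>trees_containing n (insert {x, y'} F). card (side n T x y'))
           = card (trees_containing n F)"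
proof -
  let ?B = "comp_of n F y"
  define Dom where "Dom = (SIGMA y':?B. SIGMA T:trees_containing n (insert {x, y'} F). side n T x y')"
  define g where "g = (\<lambda>(y', T, v). insert {v, y'} (T - {{x, y' :: nat}}))"
  have fin: "finite ?B" "\<And>T y'. finite (side n T x y')"
    by (auto simp: comp_of_def side_def)
  have B: "y' \<in> {1..n}" "linked F y y'" "\<not> linked F x y'" "{x, y'} \<notin> F" if "y' \<in> ?B" for y'
    using that xy(3) by (auto simp: comp_of_def dest: linked_sym linked_trans linked_edge)
  have DomD: "insert {v, y'} (T - {{x, y'}}) \<in> trees_containing n F" "{v, y'} \<notin> T - {{x, y'}}"
      "{x, y'} \<in> T" "T \<in> spanning_trees n" "linked (T - {{x, y'}}) x v" "F \<subseteq> T - {{x, y'}}"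
    if "y' \<in> ?B" "T \<in> trees_containing n (insert {x, y'} F)" "v \<in> side n T x y'" for y' T v
  proof -
    show T: "T \<in> spanning_trees n" "{x, y'} \<in> T" "linked (T - {{x, y'}}) x v"
      using that by (auto simp: trees_containing_def side_def)
    show "F \<subseteq> T - {{x, y'}}"
      using that B(4)[OF that(1)] by (auto simp: trees_containing_def)
    have v: "v \<in> {1..n}" using that by (auto simp: side_def)
    note sw = tree_swap[OF T(1,2) v B(1)[OF that(1)] T(3) linked_refl]
    show "{v, y'} \<notin> T - {{x, y'}}" by (rule sw(2))
    show "insert {v, y'} (T - {{x, y'}}) \<in> trees_containing n F"
      using sw(1) \<open>F \<subseteq> T - {{x, y'}}\<close> by (auto simp: trees_containing_def)
  qed
  \<comment> \<open>A tree determines its exit edge. Two different candidates would close a cycle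
    through \<open>x\<close>, \<open>v1\<close>, \<open>y1\<close>, \<open>y2\<close>,
    \<open>v2\<close>, because \<open>y1\<close> and \<open>y2\<close> are joined inside
    \<open>F\<close>. If it is one edge with the roles of its ends exchanged, both ends lie in the
    component of \<open>y\<close>, so \<open>F\<close> joins them without that edge, which is then
    no bridge.\<close>
  have key: "y1 = y2 \<and> v1 = v2"
    if T: "T \<in> spanning_trees n" "F \<subseteq> T - {{v1, y1}}" "F \<subseteq> T - {{v2, y2}}"
      "{v1, y1} \<in> T" "{v2, y2} \<in> T" "y1 \<in> ?B" "y2 \<in> ?B"
      "linked (T - {{v1, y1}}) x v1" "linked (T - {{v2, y2}}) x v2" for T v1 y1 v2 y2
  proof (cases "{v1, y1} = {v2, y2}")
    case True
    have yy: "linked F y1 y2"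
      using B(2)[OF T(6)] B(2)[OF T(7)] by (meson linked_trans linked_sym)
    show ?thesis
    proof (rule ccontr)
      assume "\<not> ?thesis"
      with True have "v1 = y2" "v2 = y1"
        by (auto simp: doubleton_eq_iff)
      with yy have "linked F v1 y1"
        by (simp add: linked_commute)
      then have "linked (T - {{v1, y1}}) v1 y1"
        using T(2) by (rule linked_mono)
      with spanning_treeD(3)[OF T(1,4)] show False by blast
    qed
  next
    case False
    define D where "D = T - {{v1, y1}, {v2, y2}}"
    have D: "T - {{v1, y1}} = insert {v2, y2} D" "T - {{v2, y2}} = insert {v1, y1} D"
      using False T(4,5) by (auto simp: D_def)
    have "linked F y1 y2"
      using B(2)[OF T(6)] B(2)[OF T(7)] by (meson linked_trans linked_sym)
    then have yy: "linked D y1 y2"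
      by (rule linked_mono) (use T(2,3) in \<open>auto simp: D_def\<close>)
    have n1: "\<not> linked (insert {v2, y2} D) v1 y1" and n2: "\<not> linked (insert {v1, y1} D) v2 y2"
      using spanning_treeD(3)[OF T(1,4)] spanning_treeD(3)[OF T(1,5)] unfolding D by auto
    have l1: "linked (insert {v2, y2} D) x v1" and l2: "linked (insert {v1, y1} D) x v2"
      using T(8,9) unfolding D by auto
    have False
      using n1 n2 l1 l2 yy unfolding linked_insert by (meson linked_trans linked_sym)
    then show ?thesis ..
  qed
  have "bij_betw g Dom (trees_containing n F)"
    unfolding bij_betw_def
  proof
    show "inj_on g Dom"
    proof (rule inj_onI, clarsimp simp: Dom_def g_def)
      fix y1 T1 v1 y2 T2 v2
      assume d1: "y1 \<in> ?B" "T1 \<in> trees_containing n (insert {x, y1} F)" "v1 \<in> side n T1 x y1"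
        and d2: "y2 \<in> ?B" "T2 \<in> trees_containing n (insert {x, y2} F)" "v2 \<in> side n T2 x y2"
        and eq: "insert {v1, y1} (T1 - {{x, y1}}) = insert {v2, y2} (T2 - {{x, y2}})"
      define T where "T = insert {v1, y1} (T1 - {{x, y1}})"
      note D1 = DomD[OF d1] and D2 = DomD[OF d2]
      have T1: "T - {{v1, y1}} = T1 - {{x, y1}}" "{v1, y1} \<in> T"
        using D1(2) by (auto simp: T_def)
      have T2: "T - {{v2, y2}} = T2 - {{x, y2}}" "{v2, y2} \<in> T"
        using D2(2) by (auto simp: T_def eq)
      have "T \<in> spanning_trees n"
        using D1(1) by (simp add: T_def trees_containing_def)
      then have *: "y1 = y2 \<and> v1 = v2"
        by (rule key) (use D1 D2 d1 d2 T1 T2 in auto)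
      have "T1 = insert {x, y1} (T - {{v1, y1}})" "T2 = insert {x, y2} (T - {{v2, y2}})"
        unfolding T1 T2 using D1(3) D2(3) by auto
      with * show "y1 = y2 \<and> T1 = T2 \<and> v1 = v2" by simp
    qed
    show "g ` Dom = trees_containing n F"
    proof
      show "g ` Dom \<subseteq> trees_containing n F"
        using DomD(1) by (auto simp: Dom_def g_def)
      show "trees_containing n F \<subseteq> g ` Dom"
      proof
        fix T assume "T \<in> trees_containing n F"
        then have T: "T \<in> spanning_trees n" "F \<subseteq> T"
          by (auto simp: trees_containing_def)
        have "y \<in> ?B" "x \<notin> ?B"
          using xy by (auto simp: comp_of_def linked_commute[of _ y])
        then obtain y' v where v: "y' \<in> ?B" "v \<notin> ?B" "{y', v} \<in> T" "linked (T - {{y', v}}) v x"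
          using linked_exit[OF spanning_treeD(2)[OF T(1) xy(2,1)]] by blast
        define T' where "T' = insert {y', x} (T - {{y', v}})"
        have vn: "v \<in> {1..n}"
          using spanning_treeD(1)[OF T(1)] v(3) by (auto simp: complete_edges_def)
        note sw = tree_swap[OF T(1) v(3) B(1)[OF v(1)] xy(1) linked_refl v(4)]
        \<comment> \<open>An edge of \<open>F\<close> cannot leave a component of \<open>F\<close>;
          so the exchange keeps \<open>F\<close> in the tree.\<close>
        have "{y', v} \<notin> F"
          using v(1,2) vn by (auto simp: comp_of_def dest: linked_trans linked_edge)
        then have "T' \<in> trees_containing n (insert {x, y'} F)"
          using sw(1) T(2) unfolding T'_def trees_containing_def by (auto simp: insert_commute)
        moreover have eq: "T' - {{x, y'}} = T - {{y', v}}"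
          using sw(2) unfolding T'_def by (simp add: insert_commute)
        then have "v \<in> side n T' x y'"
          using v(4) vn by (simp add: side_def linked_commute)
        ultimately have "(y', T', v) \<in> Dom"
          using v(1) by (simp add: Dom_def)
        moreover have "g (y', T', v) = T"
          using v(3) unfolding g_def by (simp add: eq insert_commute insert_absorb)
        ultimately show "T \<in> g ` Dom" by force
      qed
    qed
  qed
  then have "card (trees_containing n F) = card Dom"
    by (simp add: bij_betw_same_card)
  also have "\<dots> = (\<Sum>y'\<in>?B. \<Sum>T\<in>trees_containing n (insert {x, y'} F). card (side n T x y'))"
    using fin unfolding Dom_def by (simp add: card_SigmaI finite_SigmaI)
  finally show ?thesis ..
qed

text \<open>Since \<open>F\<close> joins \<open>y1\<close> to \<open>y2\<close>, moving the end of
  the edge from one to the other gives a tree again. The forest left after deleting the edge is the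
  same, hence so is the side of \<open>x\<close>. All terms of the outer sum in
  \<open>sum_card_sides\<close> are therefore equal.\<close>

lemma sum_card_side_swap:
  assumes F: "\<not> linked F x y" and x: "x \<in> {1..n}"
    and y': "y1 \<in> comp_of n F y" "y2 \<in> comp_of n F y"
  shows "(\<Sum>T\<in>trees_containing n (insert {x, y1} F). card (side n T x y1)) =
         (\<Sum>T\<in>trees_containing n (insert {x, y2} F). card (side n T x y2))"
proof -
  define h where "h = (\<lambda>y1 y2 T. insert {x, y2} (T - {{x, y1 :: nat}}))"
  have *: "h z1 z2 T \<in> trees_containing n (insert {x, z2} F)" "h z2 z1 (h z1 z2 T) = T"
      "side n (h z1 z2 T) x z2 = side n T x z1"
    if z: "z1 \<in> comp_of n F y" "z2 \<in> comp_of n F y"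
      and T: "T \<in> trees_containing n (insert {x, z1} F)" for z1 z2 T
  proof -
    have T': "T \<in> spanning_trees n" "{x, z1} \<in> T" "F \<subseteq> T"
      using T by (auto simp: trees_containing_def)
    have "{x, z1} \<notin> F"
      using z(1) F by (auto simp: comp_of_def dest: linked_sym linked_trans linked_edge)
    with T' have FT: "F \<subseteq> T - {{x, z1}}" by auto
    have "linked F z1 z2"
      using z by (auto simp: comp_of_def intro: linked_trans linked_sym)
    then have l: "linked (T - {{x, z1}}) z1 z2"
      using FT by (rule linked_mono)
    have z2: "z2 \<in> {1..n}" using z(2) by (auto simp: comp_of_def)
    note sw = tree_swap[OF T'(1,2) x z2 linked_refl l]
    have eq: "h z1 z2 T - {{x, z2}} = T - {{x, z1}}"
      unfolding h_def using sw(2) by auto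
    show "h z1 z2 T \<in> trees_containing n (insert {x, z2} F)"
      using sw(1) FT by (auto simp: h_def trees_containing_def)
    show "h z2 z1 (h z1 z2 T) = T"
    proof -
      have "h z2 z1 (h z1 z2 T) = insert {x, z1} (h z1 z2 T - {{x, z2}})"
        by (simp add: h_def)
      then show ?thesis
        unfolding eq using T'(2) by auto
    qed
    show "side n (h z1 z2 T) x z2 = side n T x z1"
      by (simp add: side_def eq)
  qed
  show ?thesis
    by (rule sum.reindex_bij_witness[of _ "h y2 y1" "h y1 y2"]) (use * y' in auto)
qed

lemma card_comp_sum_card_sides:
  assumes "F \<subseteq> complete_edges n" "x \<in> {1..n}" "y \<in> {1..n}" "\<not> linked F x y"
  shows "card (comp_of n F y) * (\<Sum>T\<in>trees_containing n (insert {x, y} F). card (side n T x y))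
           = card (trees_containing n F)"
proof -
  have "y \<in> comp_of n F y"
    using assms(3) by (simp add: comp_of_def)
  then have "(\<Sum>y'\<in>comp_of n F y. \<Sum>T\<in>trees_containing n (insert {x, y'} F). card (side n T x y'))
      = (\<Sum>y'\<in>comp_of n F y. \<Sum>T\<in>trees_containing n (insert {x, y} F). card (side n T x y))"
    by (intro sum.cong[OF refl] sum_card_side_swap[OF assms(4,2)])
  then show ?thesis
    using sum_card_sides[OF assms] by simp
qed

text \<open>The identity of \<open>card_comp_sum_card_sides\<close> is used once for each end of the
  edge, and the sizes of the two sides add up to n; multiplying by \<open>a * b\<close> clears the
  denominators.\<close>

lemma card_trees_containing_insert:
  assumes F: "F \<subseteq> complete_edges n" and xy: "x \<in> {1..n}" "y \<in> {1..n}" "\<not> linked F x y"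
  defines "a \<equiv> card (comp_of n F x)" and "b \<equiv> card (comp_of n F y)"
  shows "n * a * b * card (trees_containing n (insert {x, y} F)) =
           (a + b) * card (trees_containing n F)"
proof -
  let ?X = "trees_containing n (insert {x, y} F)"
  have ab: "b * (\<Sum>T\<in>?X. card (side n T x y)) = card (trees_containing n F)"
    unfolding b_def using card_comp_sum_card_sides[OF F xy] .
  have ba: "a * (\<Sum>T\<in>?X. card (side n T y x)) = card (trees_containing n F)"
    unfolding a_def using card_comp_sum_card_sides[OF F xy(2,1)] xy(3)
    by (simp add: linked_commute insert_commute)
  have "n * card ?X = (\<Sum>T\<in>?X. card (side n T x y) + card (side n T y x))"
    using card_sides[of _ n x y] by (simp add: trees_containing_def)
  also have "\<dots> = (\<Sum>T\<in>?X. card (side n T x y)) + (\<Sum>T\<in>?X. card (side n T y x))"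
    by (rule sum.distrib)
  finally have *: "n * card ?X = \<dots>" .
  have "n * a * b * card ?X = a * b * (n * card ?X)"
    by (simp add: mult_ac)
  also have "\<dots> = a * (b * (\<Sum>T\<in>?X. card (side n T x y))) + b * (a * (\<Sum>T\<in>?X. card (side n T y x)))"
    unfolding * by (simp add: algebra_simps)
  finally have "n * a * b * card ?X = \<dots>" .
  then show ?thesis
    unfolding ab ba by (simp add: algebra_simps)
qed

section \<open>Inclusion probabilities of a uniform spanning tree\<close>

definition tree_prob :: "nat \<Rightarrow> nat set set \<Rightarrow> real" where
  "tree_prob n F = real (card (trees_containing n F)) / real (card (spanning_trees n))"

lemma card_spanning_trees_pos: "n \<ge> 1 \<Longrightarrow> card (spanning_trees n) > 0"
  using spanning_trees_nonempty finite_spanning_trees by (simp add: card_gt_0_iff)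

lemma tree_prob_nonneg [simp]: "tree_prob n F \<ge> 0"
  by (simp add: tree_prob_def)

lemma tree_prob_empty: "n \<ge> 1 \<Longrightarrow> tree_prob n {} = 1"
  using card_spanning_trees_pos[of n] by (simp add: tree_prob_def trees_containing_def)

lemma tree_prob_insert:
  assumes "F \<subseteq> complete_edges n" "x \<in> {1..n}" "y \<in> {1..n}" "\<not> linked F x y"
    and "card (comp_of n F x) = a" "card (comp_of n F y) = b"
  shows "tree_prob n (insert {x, y} F) = (1 / real a + 1 / real b) / real n * tree_prob n F"
proof -
  have "x \<in> comp_of n F x" "y \<in> comp_of n F y" "finite (comp_of n F x)" "finite (comp_of n F y)"
    using assms(2,3) by (auto simp: comp_of_def)
  then have pos: "a > 0" "b > 0" "n > 0"
    using assms(2,5,6) card_gt_0_iff by auto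
  have "real (n * a * b * card (trees_containing n (insert {x, y} F))) =
      real ((a + b) * card (trees_containing n F))"
    using card_trees_containing_insert[OF assms(1-4)] unfolding assms(5,6) by (simp only:)
  then have "real (card (trees_containing n (insert {x, y} F))) =
      (1 / real a + 1 / real b) / real n * real (card (trees_containing n F))"
    using pos by (simp add: field_simps)
  then show ?thesis
    by (simp add: tree_prob_def)
qed

text \<open>Components have at least one vertex, so 1/a + 1/b is at most 2. If the ends of
  \<open>e\<close> are linked in \<open>F\<close> already, adding \<open>e\<close> closes a cycle
  and the left side is 0.\<close>

lemma tree_prob_insert_le:
  assumes "F \<subseteq> complete_edges n" "e \<in> complete_edges n" "e \<notin> F"
  shows "tree_prob n (insert e F) \<le> 2 / real n * tree_prob n F"
proof -
  obtain x y where e: "e = {x, y}" "x \<noteq> y" "x \<in> {1..n}" "y \<in> {1..n}"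
    using assms(2) by (auto simp: complete_edges_def card_2_iff)
  show ?thesis
  proof (cases "linked F x y")
    case True
    have "trees_containing n (insert e F) = {}"
    proof -
      have False if "T \<in> spanning_trees n" "insert {x, y} F \<subseteq> T" for T
      proof -
        have "linked (T - {{x, y}}) x y"
          using True by (rule linked_mono) (use that assms(3) e in auto)
        with spanning_treeD(3)[OF that(1)] that(2) show False by blast
      qed
      then show ?thesis by (auto simp: trees_containing_def e)
    qed
    then show ?thesis by (simp add: tree_prob_def)
  next
    case False
    define a b where "a = card (comp_of n F x)" and "b = card (comp_of n F y)"
    have "x \<in> comp_of n F x" "y \<in> comp_of n F y" "finite (comp_of n F x)" "finite (comp_of n F y)"
      using e(3,4) by (auto simp: comp_of_def)
    then have "a > 0" "b > 0"
      unfolding a_def b_def by (auto simp: card_gt_0_iff)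
    then have "1 / real a + 1 / real b \<le> 1 + 1"
      by (intro add_mono) (auto simp: divide_simps)
    then have "(1 / real a + 1 / real b) / real n * tree_prob n F \<le> 2 / real n * tree_prob n F"
      by (intro mult_right_mono divide_right_mono) auto
    then show ?thesis
      using tree_prob_insert[OF assms(1) e(3,4) False a_def[symmetric] b_def[symmetric]]
      by (simp add: e(1))
  qed
qed

lemma tree_prob_union_le:
  assumes "finite F'" "F \<subseteq> complete_edges n" "F' \<subseteq> complete_edges n" "F \<inter> F' = {}"
  shows "tree_prob n (F \<union> F') \<le> (2 / real n) ^ card F' * tree_prob n F"
  using assms(1,3,4)
proof (induction F' rule: finite_induct)
  case (insert e F')
  have "tree_prob n (insert e (F \<union> F')) \<le> 2 / real n * tree_prob n (F \<union> F')"
    using insert assms(2) by (intro tree_prob_insert_le) auto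
  also have "\<dots> \<le> 2 / real n * ((2 / real n) ^ card F' * tree_prob n F)"
    using insert by (intro mult_left_mono) auto
  finally show ?case
    using insert.hyps by (simp add: mult_ac)
qed simp

lemma tree_prob_le:
  assumes "n \<ge> 1" "F \<subseteq> complete_edges n"
  shows "tree_prob n F \<le> (2 / real n) ^ card F"
  using tree_prob_union_le[of F "{}" n] assms finite_subset[OF _ finite_complete_edges]
  by (simp add: tree_prob_empty)

lemma doubleton_complete_edges:
  "{x, y} \<in> complete_edges n \<longleftrightarrow> x \<noteq> y \<and> x \<in> {1..n} \<and> y \<in> {1..n}"
  by (auto simp: complete_edges_def card_2_iff doubleton_eq_iff)

lemma tree_prob_edge:
  assumes "e \<in> complete_edges n"
  shows "tree_prob n {e} = 2 / real n"
proof -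
  obtain x y where e: "e = {x, y}" "x \<noteq> y" "x \<in> {1..n}" "y \<in> {1..n}"
    using assms by (auto simp: complete_edges_def card_2_iff)
  have "comp_of n {} z = {z}" if "z \<in> {1..n}" for z
    using that by (auto simp: comp_of_def)
  then have "tree_prob n (insert {x, y} {}) = (1 / real 1 + 1 / real 1) / real n * tree_prob n {}"
    using e by (intro tree_prob_insert) auto
  then show ?thesis
    using e by (simp add: tree_prob_empty)
qed

text \<open>The second edge joins a component of size 2 to one of size 1, hence the factor 1/2 + 1
  where two independent edges would give 2. This deficit is the signal that the wedge statistic
  detects.\<close>

lemma tree_prob_wedge:
  assumes "{v, a, b} \<subseteq> {1..n}" "distinct [v, a, b]"
  shows "tree_prob n {{v, a}, {v, b}} = 3 / real n ^ 2"
proof -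
  have "comp_of n {{v, a}} v = {v, a}" "comp_of n {{v, a}} b = {b}"
    using assms by (auto simp: comp_of_def linked_insert)
  then have "tree_prob n (insert {v, b} {{v, a}}) =
      (1 / real 2 + 1 / real 1) / real n * tree_prob n {{v, a}}"
    using assms by (intro tree_prob_insert) (auto simp: linked_insert doubleton_complete_edges)
  also have "tree_prob n {{v, a}} = 2 / real n"
    using assms by (intro tree_prob_edge) (auto simp: doubleton_complete_edges)
  finally show ?thesis
    by (simp add: insert_commute power2_eq_square)
qed

text \<open>The value is exactly the square of that for one wedge. This absence of correlation lets
  the leading terms cancel in the variance of the number of wedges.\<close>

lemma tree_prob_disjoint_wedges:
  assumes "{v, a, b, w, c, d} \<subseteq> {1..n}" "distinct [v, a, b, w, c, d]"
  shows "tree_prob n {{v, a}, {v, b}, {w, c}, {w, d}} = 9 / real n ^ 4"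
proof -
  let ?F = "{{v, a}, {v, b}}"
  have "comp_of n ?F w = {w}" "comp_of n ?F c = {c}"
    using assms by (auto simp: comp_of_def linked_insert)
  then have 1: "tree_prob n (insert {w, c} ?F) =
      (1 / real 1 + 1 / real 1) / real n * tree_prob n ?F"
    using assms by (intro tree_prob_insert) (auto simp: linked_insert doubleton_complete_edges)
  let ?G = "insert {w, c} ?F"
  have "comp_of n ?G w = {w, c}" "comp_of n ?G d = {d}"
    using assms by (auto simp: comp_of_def linked_insert)
  then have "tree_prob n (insert {w, d} ?G) =
      (1 / real 2 + 1 / real 1) / real n * tree_prob n ?G"
    using assms by (intro tree_prob_insert) (auto simp: linked_insert doubleton_complete_edges)
  also have "\<dots> = 9 / real n ^ 4"
    using 1 tree_prob_wedge[of v a b n] assms by (simp add: power2_eq_square power4_eq_xxxx)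
  also have "insert {w, d} ?G = {{v, a}, {v, b}, {w, c}, {w, d}}"
    by auto
  finally show ?thesis .
qed

subsection \<open>Random graphs with independent edges\<close>

text \<open>The edge probability may vary with the edge, so that the planted law given the tree
  \<open>H\<close> is an instance: probability 1 on \<open>H\<close> and p elsewhere.\<close>

definition edge_law :: "'a set \<Rightarrow> ('a \<Rightarrow> real) \<Rightarrow> 'a set \<Rightarrow> real" where
  "edge_law K a G = (\<Prod>e\<in>G. a e) * (\<Prod>e\<in>K - G. 1 - a e)"

definition edge_exp :: "'a set \<Rightarrow> ('a \<Rightarrow> real) \<Rightarrow> ('a set \<Rightarrow> real) \<Rightarrow> real" where
  "edge_exp K a f = (\<Sum>G\<in>Pow K. edge_law K a G * f G)"

lemma edge_law_nonneg:
  assumes "\<And>e. e \<in> K \<Longrightarrow> 0 \<le> a e \<and> a e \<le> 1" "G \<subseteq> K"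
  shows "edge_law K a G \<ge> 0"
  unfolding edge_law_def using assms by (intro mult_nonneg_nonneg prod_nonneg) auto

lemma edge_exp_cong:
  assumes "\<And>G. G \<subseteq> K \<Longrightarrow> f G = g G"
  shows "edge_exp K a f = edge_exp K a g"
  unfolding edge_exp_def using assms by (intro sum.cong) auto

lemma edge_exp_mono:
  assumes "\<And>e. e \<in> K \<Longrightarrow> 0 \<le> a e \<and> a e \<le> 1" "\<And>G. G \<subseteq> K \<Longrightarrow> f G \<le> g G"
  shows "edge_exp K a f \<le> edge_exp K a g"
  unfolding edge_exp_def using edge_law_nonneg[OF assms(1)] assms(2)
  by (intro sum_mono mult_left_mono) auto

lemma edge_exp_add: "edge_exp K a (\<lambda>G. f G + g G) = edge_exp K a f + edge_exp K a g"
  by (simp add: edge_exp_def distrib_left sum.distrib)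

lemma edge_exp_cmult: "edge_exp K a (\<lambda>G. c * f G) = c * edge_exp K a f"
  by (simp add: edge_exp_def sum_distrib_left mult_ac)

lemma edge_exp_sum: "edge_exp K a (\<lambda>G. \<Sum>i\<in>I. f i G) = (\<Sum>i\<in>I. edge_exp K a (f i))"
  unfolding edge_exp_def sum_distrib_left by (rule sum.swap)

lemma edge_exp_insert:
  assumes "finite K" "e \<notin> K"
  shows "edge_exp (insert e K) a f = edge_exp K a (\<lambda>G. a e * f (insert e G) + (1 - a e) * f G)"
proof -
  have inj: "inj_on (insert e) (Pow K)"
    using assms(2) by (auto simp: inj_on_def)
  have 1: "edge_law (insert e K) a (insert e G) = a e * edge_law K a G"
    and 2: "edge_law (insert e K) a G = (1 - a e) * edge_law K a G" if "G \<subseteq> K" for G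
  proof -
    have "finite G" "e \<notin> G" "insert e K - insert e G = K - G" "insert e K - G = insert e (K - G)"
      using that assms finite_subset by auto
    then show "edge_law (insert e K) a (insert e G) = a e * edge_law K a G"
        "edge_law (insert e K) a G = (1 - a e) * edge_law K a G"
      using assms by (simp_all add: edge_law_def)
  qed
  have "edge_exp (insert e K) a f =
      (\<Sum>G\<in>Pow K. edge_law (insert e K) a G * f G) +
      (\<Sum>G\<in>insert e ` Pow K. edge_law (insert e K) a G * f G)"
    unfolding edge_exp_def Pow_insert
    by (rule sum.union_disjoint) (use assms in auto)
  also have "\<dots> = (\<Sum>G\<in>Pow K. (1 - a e) * edge_law K a G * f G) +
      (\<Sum>G\<in>Pow K. a e * edge_law K a G * f (insert e G))"
    using 1 2 inj by (simp add: sum.reindex)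
  finally show ?thesis
    by (simp add: edge_exp_def sum.distrib[symmetric] algebra_simps)
qed

lemma edge_exp_const:
  assumes "finite K"
  shows "edge_exp K a (\<lambda>_. c) = c"
proof -
  have "(\<Sum>G\<in>Pow K. edge_law K a G) = (\<Prod>e\<in>K. a e + (1 - a e))"
    unfolding edge_law_def using prod_add[OF assms, of a "\<lambda>e. 1 - a e"] by simp
  then show ?thesis
    by (simp add: edge_exp_def flip: sum_distrib_right)
qed

text \<open>The assumption on \<open>Z\<close> expresses that \<open>Z\<close> does not look at the
  edge \<open>e\<close>, so conditioning on the other edges factors the expectation.\<close>

lemma edge_exp_indep:
  assumes "finite K" "e \<in> K" "\<And>G. Z (insert e G) = Z (G - {e})"
  shows "edge_exp K a (\<lambda>G. g (e \<in> G) * Z G) = (a e * g True + (1 - a e) * g False) * edge_exp K a Z"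
proof -
  define K' where "K' = K - {e}"
  have K: "K = insert e K'" "e \<notin> K'" "finite K'"
    using assms(1,2) by (auto simp: K'_def)
  have Z: "Z (insert e G) = Z G" if "e \<notin> G" for G
    using assms(3)[of G] that by simp
  have notin: "e \<notin> G" if "G \<subseteq> K'" for G
    using that K(2) by blast
  have "edge_exp K a (\<lambda>G. g (e \<in> G) * Z G) =
      edge_exp K' a (\<lambda>G. (a e * g True + (1 - a e) * g False) * Z G)"
    unfolding K(1) edge_exp_insert[OF K(3,2)]
    by (rule edge_exp_cong) (simp add: notin Z algebra_simps)
  moreover have "edge_exp K a Z = edge_exp K' a Z"
    unfolding K(1) edge_exp_insert[OF K(3,2)]
    by (rule edge_exp_cong) (simp add: notin Z algebra_simps)
  ultimately show ?thesis
    by (simp add: edge_exp_cmult)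
qed

section \<open>Moments of centred edge indicators\<close>

definition centred :: "('a \<Rightarrow> real) \<Rightarrow> 'a \<Rightarrow> 'a set \<Rightarrow> real" where
  "centred a e G = of_bool (e \<in> G) - a e"

lemma edge_exp_centred_indep:
  assumes "finite K" "e \<in> K" "\<And>G. Z (insert e G) = Z (G - {e})"
  shows "edge_exp K a (\<lambda>G. centred a e G * Z G) = 0"
  using edge_exp_indep[OF assms, of a "\<lambda>b. of_bool b - a e"]
  by (simp add: centred_def algebra_simps)

lemma edge_exp_centred_square_indep:
  assumes "finite K" "e \<in> K" "\<And>G. Z (insert e G) = Z (G - {e})"
  shows "edge_exp K a (\<lambda>G. (centred a e G)\<^sup>2 * Z G) = a e * (1 - a e) * edge_exp K a Z"
  using edge_exp_indep[OF assms, of a "\<lambda>b. (of_bool b - a e)\<^sup>2"]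
  by (simp add: centred_def algebra_simps power2_eq_square)

lemma centred_insert: "f \<noteq> e \<Longrightarrow> centred a f (insert e G) = centred a f (G - {e})"
  by (simp add: centred_def)

lemma edge_exp_centred_square:
  assumes "finite K" "e \<in> K"
  shows "edge_exp K a (\<lambda>G. (centred a e G)\<^sup>2) = a e * (1 - a e)"
  using edge_exp_centred_square_indep[OF assms, of "\<lambda>_. 1" a] assms(1)
  by (simp add: edge_exp_const)

text \<open>An index that occurs only once among the four makes the expectation vanish. As
  \<open>e\<close> differs from \<open>f\<close> and \<open>g\<close> from \<open>h\<close>, what
  remains is the equality of the two unordered pairs.\<close>

lemma edge_exp_four_centred:
  assumes "finite K" "{e, f, g, h} \<subseteq> K" "e \<noteq> f" "g \<noteq> h"
  shows "edge_exp K a (\<lambda>G. (centred a e G * centred a f G) * (centred a g G * centred a h G)) =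
    (if (g, h) = (e, f) \<or> (g, h) = (f, e) then (a e * (1 - a e)) * (a f * (1 - a f)) else 0)"
    (is "edge_exp K a ?Y = _")
proof -
  consider "e \<notin> {g, h}" | "f \<notin> {g, h}" | "(g, h) = (e, f) \<or> (g, h) = (f, e)"
    using assms(3,4) by auto
  then show ?thesis
  proof cases
    case 1
    have "edge_exp K a (\<lambda>G. centred a e G * (centred a f G * centred a g G * centred a h G)) = 0"
      using 1 assms by (intro edge_exp_centred_indep) (auto simp: centred_insert)
    with 1 show ?thesis by (auto simp: mult_ac)
  next
    case 2
    have "edge_exp K a (\<lambda>G. centred a f G * (centred a e G * centred a g G * centred a h G)) = 0"
      using 2 assms by (intro edge_exp_centred_indep) (auto simp: centred_insert)
    with 2 show ?thesis by (auto simp: mult_ac)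
  next
    case 3
    have "edge_exp K a ?Y = edge_exp K a (\<lambda>G. (centred a e G)\<^sup>2 * (centred a f G)\<^sup>2)"
      using 3 by (intro edge_exp_cong) (auto simp: power2_eq_square mult_ac)
    also have "\<dots> = a e * (1 - a e) * edge_exp K a (\<lambda>G. (centred a f G)\<^sup>2)"
      using assms by (intro edge_exp_centred_square_indep) (auto simp: centred_insert)
    finally show ?thesis
      using 3 assms by (simp add: edge_exp_centred_square)
  qed
qed

lemma edge_exp_linear_form:
  assumes "finite K"
  shows "edge_exp K a (\<lambda>G. (\<Sum>e\<in>K. centred a e G * L e)\<^sup>2) = (\<Sum>e\<in>K. a e * (1 - a e) * (L e)\<^sup>2)"
proof -
  have "edge_exp K a (\<lambda>G. (\<Sum>e\<in>K. centred a e G * L e)\<^sup>2) =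
      (\<Sum>e\<in>K. \<Sum>f\<in>K. edge_exp K a (\<lambda>G. (L e * L f) * (centred a e G * centred a f G)))"
    unfolding power2_eq_square sum_product edge_exp_sum by (simp add: mult_ac)
  also have "\<dots> = (\<Sum>e\<in>K. \<Sum>f\<in>K. if f = e then a e * (1 - a e) * (L e)\<^sup>2 else 0)"
  proof (intro sum.cong refl)
    fix e f assume ef: "e \<in> K" "f \<in> K"
    have "edge_exp K a (\<lambda>G. centred a e G * centred a f G) = (if f = e then a e * (1 - a e) else 0)"
      using edge_exp_centred_indep[OF assms ef(1), of "centred a f" a]
        edge_exp_centred_square[OF assms ef(1), of a]
      by (auto simp: centred_insert power2_eq_square)
    then show "edge_exp K a (\<lambda>G. (L e * L f) * (centred a e G * centred a f G)) =
        (if f = e then a e * (1 - a e) * (L e)\<^sup>2 else 0)"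
      by (simp add: edge_exp_cmult power2_eq_square)
  qed
  finally show ?thesis
    using assms by simp
qed

text \<open>By orthogonality a pair correlates only with itself and its reversal, which is the
  origin of the factor 2.\<close>

lemma edge_exp_quadratic_form:
  assumes "finite K" "D \<subseteq> K \<times> K" "\<And>e f. (e, f) \<in> D \<Longrightarrow> e \<noteq> f"
    and a: "\<And>e. e \<in> K \<Longrightarrow> 0 \<le> a e \<and> a e \<le> 1 \<and> a e * (1 - a e) \<le> \<sigma>"
  shows "edge_exp K a (\<lambda>G. (\<Sum>(e, f)\<in>D. centred a e G * centred a f G)\<^sup>2) \<le> 2 * real (card D) * \<sigma>\<^sup>2"
proof -
  let ?s = "\<lambda>e. a e * (1 - a e)"
  have finD: "finite D"
    using assms(1,2) finite_subset by blast
  have s: "0 \<le> ?s e" "?s e \<le> \<sigma>" if "e \<in> K" for e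
    using a[OF that] by auto
  have "edge_exp K a (\<lambda>G. (\<Sum>(e, f)\<in>D. centred a e G * centred a f G)\<^sup>2) =
     (\<Sum>(e, f)\<in>D. \<Sum>(g, h)\<in>D.
        edge_exp K a (\<lambda>G. (centred a e G * centred a f G) * (centred a g G * centred a h G)))"
    unfolding power2_eq_square sum_product edge_exp_sum split_def by simp
  also have "\<dots> = (\<Sum>(e, f)\<in>D. \<Sum>(g, h)\<in>D. if (g, h) = (e, f) \<or> (g, h) = (f, e) then ?s e * ?s f else 0)"
  proof (intro sum.cong refl, clarify)
    fix e f assume ef: "(e, f) \<in> D"
    show "(\<Sum>(g, h)\<in>D. edge_exp K a
          (\<lambda>G. (centred a e G * centred a f G) * (centred a g G * centred a h G))) =
        (\<Sum>(g, h)\<in>D. if (g, h) = (e, f) \<or> (g, h) = (f, e) then ?s e * ?s f else 0)"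
    proof (intro sum.cong refl, clarify)
      fix g h assume "(g, h) \<in> D"
      then show "edge_exp K a (\<lambda>G. (centred a e G * centred a f G) * (centred a g G * centred a h G)) =
          (if (g, h) = (e, f) \<or> (g, h) = (f, e) then ?s e * ?s f else 0)"
        using ef assms(2,3) by (intro edge_exp_four_centred[OF assms(1)]) auto
    qed
  qed
  also have "\<dots> \<le> (\<Sum>(e, f)\<in>D. 2 * \<sigma>\<^sup>2)"
  proof (intro sum_mono, clarify)
    fix e f assume ef: "(e, f) \<in> D"
    then have K: "e \<in> K" "f \<in> K" using assms(2) by auto
    have "(\<Sum>(g, h)\<in>D. if (g, h) = (e, f) \<or> (g, h) = (f, e) then ?s e * ?s f else 0) =
        (\<Sum>x\<in>D. if x = (e, f) \<or> x = (f, e) then ?s e * ?s f else 0)"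
      by (simp add: split_def prod_eq_iff)
    also have "\<dots> = (\<Sum>x\<in>D \<inter> {(e, f), (f, e)}. ?s e * ?s f)"
      by (subst sum.inter_restrict[OF finD]) simp
    also have "\<dots> \<le> (\<Sum>x\<in>{(e, f), (f, e)}. ?s e * ?s f)"
      using s K by (intro sum_mono2) auto
    also have "\<dots> = real (card {(e, f), (f, e)}) * (?s e * ?s f)"
      by (rule sum_constant)
    also have "\<dots> \<le> 2 * (\<sigma> * \<sigma>)"
    proof (rule mult_mono)
      show "real (card {(e, f), (f, e)}) \<le> 2"
        by (cases "e = f") auto
      show "?s e * ?s f \<le> \<sigma> * \<sigma>" "0 \<le> ?s e * ?s f"
        using mult_mono[OF s(2)[OF K(1)] s(2)[OF K(2)] order_trans[OF s[OF K(1)]] s(1)[OF K(2)]]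
          mult_nonneg_nonneg[OF s(1)[OF K(1)] s(1)[OF K(2)]] by -
    qed simp
    finally show "(\<Sum>(g, h)\<in>D. if (g, h) = (e, f) \<or> (g, h) = (f, e) then ?s e * ?s f else 0) \<le> 2 * \<sigma>\<^sup>2"
      by (simp add: power2_eq_square)
  qed
  finally show ?thesis by (simp add: mult_ac)
qed

text \<open>Write each factor as its centred part plus \<open>a e - q\<close>. The product splits
  into the subtracted constant, two linear terms that agree by the symmetry of \<open>D\<close>, and
  a quadratic term. With \<open>L\<close> the coefficients of the linear part \<open>A\<close> and
  \<open>B\<close> the quadratic part, the bound follows from (2A + B)^2 \<le> 8 A^2 + 2
  B^2.\<close>

lemma edge_exp_pair_sum_variance:
  fixes q :: real
  assumes "finite K" "D \<subseteq> K \<times> K" "\<And>e f. (e, f) \<in> D \<Longrightarrow> e \<noteq> f" "\<And>e f. (e, f) \<in> D \<Longrightarrow> (f, e) \<in> D"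
    and a: "\<And>e. e \<in> K \<Longrightarrow> 0 \<le> a e \<and> a e \<le> 1 \<and> a e * (1 - a e) \<le> \<sigma>"
  defines "L \<equiv> \<lambda>e. \<Sum>f | (e, f) \<in> D. a f - q"
  shows "edge_exp K a (\<lambda>G. ((\<Sum>(e, f)\<in>D. (of_bool (e \<in> G) - q) * (of_bool (f \<in> G) - q)) -
            (\<Sum>(e, f)\<in>D. (a e - q) * (a f - q)))\<^sup>2)
     \<le> 8 * \<sigma> * (\<Sum>e\<in>K. (L e)\<^sup>2) + 4 * real (card D) * \<sigma>\<^sup>2"
proof -
  let ?Y = "centred a"
  define A where "A = (\<lambda>G. \<Sum>e\<in>K. ?Y e G * L e)"
  define B where "B = (\<lambda>G. \<Sum>(e, f)\<in>D. ?Y e G * ?Y f G)"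
  have A1: "(\<Sum>(e, f)\<in>D. ?Y e G * (a f - q)) = A G" for G
  proof -
    have "D = Sigma K (\<lambda>e. {f. (e, f) \<in> D})"
      using assms(2) by auto
    then have "(\<Sum>(e, f)\<in>D. ?Y e G * (a f - q)) =
        (\<Sum>(e, f)\<in>Sigma K (\<lambda>e. {f. (e, f) \<in> D}). ?Y e G * (a f - q))"
      by (rule arg_cong)
    also have "\<dots> = (\<Sum>e\<in>K. \<Sum>f | (e, f) \<in> D. ?Y e G * (a f - q))"
    proof (rule sum.Sigma[symmetric])
      show "\<forall>e\<in>K. finite {f. (e, f) \<in> D}"
        using assms(1,2) by (auto intro: finite_subset[of _ K])
    qed (rule assms(1))
    finally show ?thesis
      by (simp add: A_def L_def sum_distrib_left)
  qed
  have A2: "(\<Sum>(e, f)\<in>D. (a e - q) * ?Y f G) = A G" for G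
    unfolding A1[symmetric]
    by (rule sum.reindex_bij_witness[of _ prod.swap prod.swap]) (use assms(4) in \<open>auto simp: mult_ac\<close>)
  have decomp: "(\<Sum>(e, f)\<in>D. (of_bool (e \<in> G) - q) * (of_bool (f \<in> G) - q)) -
            (\<Sum>(e, f)\<in>D. (a e - q) * (a f - q)) = 2 * A G + B G" for G
  proof -
    have "(\<Sum>(e, f)\<in>D. (of_bool (e \<in> G) - q) * (of_bool (f \<in> G) - q)) -
            (\<Sum>(e, f)\<in>D. (a e - q) * (a f - q)) =
        (\<Sum>(e, f)\<in>D. ?Y e G * (a f - q) + (a e - q) * ?Y f G + ?Y e G * ?Y f G)"
      unfolding sum_subtractf[symmetric]
      by (intro sum.cong refl) (auto simp: centred_def algebra_simps)
    also have "\<dots> = A G + A G + B G"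
      using A1[of G] A2[of G] unfolding B_def by (simp add: split_def sum.distrib)
    finally show ?thesis by simp
  qed
  have "(2 * A G + B G)\<^sup>2 \<le> 8 * (A G)\<^sup>2 + 2 * (B G)\<^sup>2" for G
    using zero_le_power2[of "2 * A G - B G"] by (simp add: power2_eq_square algebra_simps)
  then have "edge_exp K a (\<lambda>G. (2 * A G + B G)\<^sup>2) \<le> edge_exp K a (\<lambda>G. 8 * (A G)\<^sup>2 + 2 * (B G)\<^sup>2)"
    using a by (intro edge_exp_mono) auto
  also have "\<dots> = 8 * (\<Sum>e\<in>K. a e * (1 - a e) * (L e)\<^sup>2) + 2 * edge_exp K a (\<lambda>G. (B G)\<^sup>2)"
    unfolding edge_exp_add edge_exp_cmult
    unfolding A_def edge_exp_linear_form[OF assms(1)] ..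
  also have "\<dots> \<le> 8 * (\<Sum>e\<in>K. \<sigma> * (L e)\<^sup>2) + 2 * (2 * real (card D) * \<sigma>\<^sup>2)"
    unfolding B_def using a
    by (intro add_mono mult_left_mono sum_mono mult_right_mono edge_exp_quadratic_form assms(1-3)) auto
  finally show ?thesis
    unfolding decomp by (simp add: sum_distrib_left mult_ac)
qed

text \<open>Planting a fixed \<open>H\<close> keeps the edges independent and merely raises the
  probability to 1 on \<open>H\<close>.\<close>

lemma edge_exp_union:
  assumes "finite K"
  shows "edge_exp K (\<lambda>e. if e \<in> H then 1 else a e) f = edge_exp K a (\<lambda>G. f (G \<union> (H \<inter> K)))"
  using assms
proof (induction K arbitrary: f rule: finite_induct)
  case empty
  show ?case by (simp add: edge_exp_def edge_law_def)
next
  case (insert e K)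
  show ?case
  proof (cases "e \<in> H")
    case True
    then have "H \<inter> insert e K = insert e (H \<inter> K)" by auto
    then show ?thesis
      using True insert.hyps by (simp add: edge_exp_insert insert.IH algebra_simps)
  next
    case False
    then have "H \<inter> insert e K = H \<inter> K" by auto
    then show ?thesis
      using False insert.hyps by (simp add: edge_exp_insert insert.IH)
  qed
qed

lemma edge_exp_indicator:
  assumes "finite K" "G \<subseteq> K"
  shows "edge_exp K a (\<lambda>G'. of_bool (G' = G)) = edge_law K a G"
proof -
  have "edge_exp K a (\<lambda>G'. of_bool (G' = G)) = (\<Sum>G'\<in>Pow K. if G' = G then edge_law K a G else 0)"
    unfolding edge_exp_def by (intro sum.cong) auto
  then show ?thesis
    using assms by simp
qed

section \<open>The probability mass functions of the two models\<close>

lemma pmf_erdos_renyi: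
  assumes "0 \<le> a" "a \<le> 1" "G \<subseteq> complete_edges n"
  shows "pmf (erdos_renyi n a) G = edge_law (complete_edges n) (\<lambda>_. a) G"
proof -
  let ?K = "complete_edges n"
  let ?M = "Pi_pmf ?K False (\<lambda>_. bernoulli_pmf a)"
  have fin: "finite ?K" by (rule finite_complete_edges)
  have supp: "\<not> f e" if "f \<in> set_pmf ?M" "e \<notin> ?K" for f e
    using that set_Pi_pmf_subset[OF fin, of False "\<lambda>_. bernoulli_pmf a"] by auto
  have "pmf (erdos_renyi n a) G = measure_pmf.prob ?M {f. {e \<in> ?K. f e} = G}"
    unfolding erdos_renyi_def pmf_map by (simp add: vimage_def)
  \<comment> \<open>Outside \<open>complete_edges n\<close> the product law takes its default value
    \<open>False\<close> surely; so up to a null set only one function is mapped to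
    \<open>G\<close>.\<close>
  also have "\<dots> = measure_pmf.prob ?M {\<lambda>e. e \<in> G}"
    using supp assms(3)
    by (intro measure_pmf.finite_measure_eq_AE) (auto simp: AE_measure_pmf_iff fun_eq_iff)
  also have "\<dots> = pmf ?M (\<lambda>e. e \<in> G)"
    by (simp add: measure_pmf_single)
  also have "\<dots> = (\<Prod>e\<in>?K. if e \<in> G then a else 1 - a)"
    using assms by (subst pmf_Pi'[OF fin]) (auto intro!: prod.cong)
  also have "\<dots> = edge_law ?K (\<lambda>_. a) G"
  proof -
    have "?K \<inter> G = G" "?K \<inter> - G = ?K - G"
      using assms(3) by auto
    then show ?thesis
      by (simp add: prod.If_cases fin edge_law_def)
  qed
  finally show ?thesis .
qed

lemma set_pmf_erdos_renyi: "set_pmf (erdos_renyi n a) \<subseteq> Pow (complete_edges n)"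
  by (auto simp: erdos_renyi_def)

lemma pmf_planted_tree:
  assumes "0 \<le> p" "p \<le> 1" "G \<subseteq> complete_edges n" "n \<ge> 1"
  shows "pmf (planted_tree n p) G =
    (\<Sum>H\<in>spanning_trees n. edge_law (complete_edges n) (\<lambda>e. if e \<in> H then 1 else p) G)
      / real (card (spanning_trees n))"
proof -
  let ?K = "complete_edges n"
  let ?S = "spanning_trees n"
  let ?R = "erdos_renyi n p"
  have fin: "finite ?K" by (rule finite_complete_edges)
  \<comment> \<open>Drawing the tree first exhibits the law as a mixture of the laws with a fixed
    planted tree.\<close>
  have "planted_tree n p = bind_pmf (pmf_of_set ?S) (\<lambda>H. map_pmf (\<lambda>G\<^sub>0. G\<^sub>0 \<union> H) ?R)"
    unfolding planted_tree_def pair_pmf_def map_bind_pmf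
    by (subst bind_commute_pmf) (simp add: map_pmf_def bind_assoc_pmf bind_return_pmf)
  then have "pmf (planted_tree n p) G = (\<Sum>H\<in>?S. pmf (map_pmf (\<lambda>G\<^sub>0. G\<^sub>0 \<union> H) ?R) G) / real (card ?S)"
    using finite_spanning_trees spanning_trees_nonempty[OF assms(4)]
    by (simp add: pmf_bind integral_pmf_of_set)
  also have "(\<Sum>H\<in>?S. pmf (map_pmf (\<lambda>G\<^sub>0. G\<^sub>0 \<union> H) ?R) G) =
      (\<Sum>H\<in>?S. edge_law ?K (\<lambda>e. if e \<in> H then 1 else p) G)"
  proof (rule sum.cong[OF refl])
    fix H assume "H \<in> ?S"
    then have H: "H \<inter> ?K = H"
      by (auto simp: spanning_trees_def graphs_on_def)
    have "pmf (map_pmf (\<lambda>G\<^sub>0. G\<^sub>0 \<union> H) ?R) G = measure_pmf.expectation ?R (indicator {G\<^sub>0. G\<^sub>0 \<union> H = G})"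
      by (simp add: pmf_map vimage_def)
    also have "\<dots> = (\<Sum>G\<^sub>0\<in>Pow ?K. indicator {G\<^sub>0. G\<^sub>0 \<union> H = G} G\<^sub>0 * pmf ?R G\<^sub>0)"
      by (rule integral_measure_pmf_real) (use fin set_pmf_erdos_renyi in auto)
    also have "\<dots> = edge_exp ?K (\<lambda>_. p) (\<lambda>G\<^sub>0. of_bool (G\<^sub>0 \<union> (H \<inter> ?K) = G))"
      unfolding edge_exp_def H using assms(1,2)
      by (intro sum.cong) (auto simp: pmf_erdos_renyi indicator_def)
    also have "\<dots> = edge_law ?K (\<lambda>e. if e \<in> H then 1 else p) G"
      unfolding edge_exp_indicator[OF fin assms(3), symmetric] edge_exp_union[OF fin] ..
    finally show "pmf (map_pmf (\<lambda>G\<^sub>0. G\<^sub>0 \<union> H) ?R) G = edge_law ?K (\<lambda>e. if e \<in> H then 1 else p) G" .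
  qed
  finally show ?thesis .
qed

subsection \<open>The likelihood ratio\<close>

definition tree_avg :: "nat \<Rightarrow> (nat set set \<Rightarrow> real) \<Rightarrow> real" where
  "tree_avg n g = (\<Sum>T\<in>spanning_trees n. g T) / real (card (spanning_trees n))"

lemma tree_avg_const: "n \<ge> 1 \<Longrightarrow> tree_avg n (\<lambda>_. c) = c"
  using card_spanning_trees_pos[of n] by (simp add: tree_avg_def)

lemma tree_avg_add: "tree_avg n (\<lambda>T. f T + g T) = tree_avg n f + tree_avg n g"
  by (simp add: tree_avg_def sum.distrib add_divide_distrib)

lemma tree_avg_cmult: "tree_avg n (\<lambda>T. c * f T) = c * tree_avg n f"
  by (simp add: tree_avg_def flip: sum_distrib_left)

lemma tree_avg_sum: "tree_avg n (\<lambda>T. \<Sum>i\<in>I. f i T) = (\<Sum>i\<in>I. tree_avg n (f i))"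
  by (simp add: tree_avg_def sum_divide_distrib sum.swap[of _ I])

lemma tree_avg_mono:
  assumes "\<And>T. T \<in> spanning_trees n \<Longrightarrow> f T \<le> g T"
  shows "tree_avg n f \<le> tree_avg n g"
  unfolding tree_avg_def using assms by (intro divide_right_mono sum_mono) auto

lemma tree_avg_cong:
  assumes "\<And>T. T \<in> spanning_trees n \<Longrightarrow> f T = g T"
  shows "tree_avg n f = tree_avg n g"
  unfolding tree_avg_def using assms by simp

lemma tree_avg_of_bool: "tree_avg n (\<lambda>T. of_bool (F \<subseteq> T)) = tree_prob n F"
proof -
  have "(\<Sum>T\<in>spanning_trees n. of_bool (F \<subseteq> T) :: real) = real (card (trees_containing n F))"
    unfolding trees_containing_def using finite_spanning_trees
    by (simp add: of_bool_def sum.If_cases Int_def)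
  then show ?thesis
    by (simp add: tree_avg_def tree_prob_def)
qed

lemma sum_power_card_Pow:
  fixes x :: real
  assumes "finite A"
  shows "(\<Sum>X\<in>Pow A. x ^ card X) = (1 + x) ^ card A"
  using prod_add[OF assms, of "\<lambda>_. x" "\<lambda>_. 1"] by (simp add: add.commute)

text \<open>
  Expanding \<open>x ^ card (T \<inter> F)\<close> over the subsets of \<open>T \<inter> F\<close> turns the negative correlation of the
  edges of a uniform spanning tree into domination by the independent case.
\<close>

lemma tree_avg_power_Int_le:
  assumes "n \<ge> 1" "F \<subseteq> complete_edges n" "x \<ge> 1"
  shows "tree_avg n (\<lambda>T. x ^ card (T \<inter> F)) \<le> (1 + 2 * (x - 1) / real n) ^ card F"
proof -
  have fin: "finite F" using assms(2) finite_complete_edges by (rule finite_subset)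
  have "x ^ card (T \<inter> F) = (\<Sum>X\<in>Pow F. (x - 1) ^ card X * of_bool (X \<subseteq> T))" for T
  proof -
    have "x ^ card (T \<inter> F) = (\<Sum>X\<in>Pow (T \<inter> F). (x - 1) ^ card X)"
      using sum_power_card_Pow[of "T \<inter> F" "x - 1"] fin by simp
    also have "\<dots> = (\<Sum>X\<in>Pow F. (x - 1) ^ card X * of_bool (X \<subseteq> T))"
      by (rule sum.mono_neutral_cong_left) (use fin in auto)
    finally show ?thesis .
  qed
  then have "tree_avg n (\<lambda>T. x ^ card (T \<inter> F)) = (\<Sum>X\<in>Pow F. (x - 1) ^ card X * tree_prob n X)"
    by (simp only: tree_avg_sum tree_avg_cmult tree_avg_of_bool)
  also have "\<dots> \<le> (\<Sum>X\<in>Pow F. (x - 1) ^ card X * (2 / real n) ^ card X)"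
    using assms by (intro sum_mono mult_left_mono tree_prob_le) auto
  also have "\<dots> = (1 + 2 * (x - 1) / real n) ^ card F"
    using sum_power_card_Pow[OF fin, of "2 * (x - 1) / real n"]
    by (simp add: mult.commute flip: power_mult_distrib)
  finally show ?thesis .
qed

section \<open>The second moment of the likelihood ratio\<close>

lemma sum_edge_law_products:
  assumes "finite K"
  shows "(\<Sum>G\<in>Pow K. edge_law K a G * edge_law K b G / edge_law K c G) =
    (\<Prod>e\<in>K. a e * b e / c e + (1 - a e) * (1 - b e) / (1 - c e))"
  unfolding prod_add[OF assms] edge_law_def
  by (intro sum.cong refl) (simp add: prod.distrib prod_dividef)

text \<open>Cauchy-Schwarz after splitting off the weight \<open>sqrt (Q x)\<close>; the right side
  is the chi-square divergence of \<open>P\<close> from \<open>Q\<close>.\<close>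

lemma sum_abs_diff_le_chi_square:
  fixes P Q :: "'a \<Rightarrow> real"
  assumes "\<And>x. x \<in> A \<Longrightarrow> Q x > 0" "sum P A = 1" "sum Q A = 1"
  shows "(\<Sum>x\<in>A. \<bar>P x - Q x\<bar>)\<^sup>2 \<le> (\<Sum>x\<in>A. (P x)\<^sup>2 / Q x) - 1"
proof -
  have "(\<Sum>x\<in>A. \<bar>P x - Q x\<bar>)\<^sup>2 = (\<Sum>x\<in>A. (\<bar>P x - Q x\<bar> / sqrt (Q x)) * sqrt (Q x))\<^sup>2"
    by (intro arg_cong[where f = "\<lambda>s. s\<^sup>2"] sum.cong) (use assms(1) less_irrefl in force)+
  also have "\<dots> \<le> (\<Sum>x\<in>A. (\<bar>P x - Q x\<bar> / sqrt (Q x))\<^sup>2) * (\<Sum>x\<in>A. (sqrt (Q x))\<^sup>2)"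
    by (rule Cauchy_Schwarz_ineq_sum)
  also have "(\<Sum>x\<in>A. (sqrt (Q x))\<^sup>2) = 1"
    using assms(1,3) by (simp add: less_imp_le)
  also have "(\<Sum>x\<in>A. (\<bar>P x - Q x\<bar> / sqrt (Q x))\<^sup>2) = (\<Sum>x\<in>A. (P x)\<^sup>2 / Q x - 2 * P x + Q x)"
  proof (rule sum.cong[OF refl])
    fix x assume "x \<in> A"
    then have "Q x > 0" by (rule assms(1))
    then show "(\<bar>P x - Q x\<bar> / sqrt (Q x))\<^sup>2 = (P x)\<^sup>2 / Q x - 2 * P x + Q x"
      by (simp add: power_divide) (simp add: field_simps power2_eq_square)
  qed
  also have "\<dots> = (\<Sum>x\<in>A. (P x)\<^sup>2 / Q x) - 1"
    using assms(2,3) by (simp add: sum.distrib sum_subtractf flip: sum_distrib_left)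
  finally show ?thesis by simp
qed

lemma card_complete_edges: "card (complete_edges n) = n * (n - 1) div 2"
  using n_subsets[of "{1..n}" 2] by (simp add: complete_edges_def choose_two)

lemma real_card_complete_edges: "real (card (complete_edges n)) = real n * (real n - 1) / 2"
proof (cases n)
  case (Suc m)
  have "even (Suc m * m)" by simp
  then show ?thesis
    by (simp add: card_complete_edges Suc real_of_nat_div del: mult_Suc)
qed (simp add: card_complete_edges)

lemma sum_edge_law:
  "finite K \<Longrightarrow> (\<Sum>G\<in>Pow K. edge_law K a G) = 1"
  using edge_exp_const[of K a 1] by (simp add: edge_exp_def)

text \<open>The left side is the exponent reached in \<open>planted_chi_square_le\<close>. Up to a
  factor (n-1)/n, its leading parts are 2(1-p)/q - 4(1-p)/q + 2(1-p)/p, which collapse to 2(1-p)(1/p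
  - 1/q), of order 1/(n p^2). The constant is 4 + 12 + 4 + 8, one summand for this difference and
  one for each of the three remainders.\<close>

lemma chi_square_exponent_le:
  fixes p q d x :: real
  assumes n: "n \<ge> 3" and p: "0 < p" "p < 1" and q: "q = p + 2 * (1 - p) / real n"
  defines "d \<equiv> (q - p)\<^sup>2 / (q * (1 - q))"
  defines "x \<equiv> (1 + d) * q / p\<^sup>2"
  shows "d * (real n * (real n - 1) / 2) - 2 * (real n - 1) * ((q - p) / q) + 2 * (x - 1) / real n * (real n - 1)
     \<le> 28 / (real n * p\<^sup>2)"
proof -
  define m where "m = real n"
  have m: "m \<ge> 3" using n by (simp add: m_def)
  have qp1: "q \<ge> p" using p m unfolding q by (auto simp: m_def)
  have qp: "q \<ge> p" "q > 0" using qp1 p by linarith+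
  have q': "q - p = 2 * (1 - p) / m" "1 - q = (1 - p) * (m - 2) / m"
    using m unfolding q m_def by (auto simp: field_simps)
  have d: "d = 4 * (1 - p) / (q * m * (m - 2))"
    unfolding d_def q' using m p qp by (simp add: divide_simps power2_eq_square) (simp add: algebra_simps)
  have qpp: "q - p\<^sup>2 = (1 - p) * (p + 2 / m)"
    unfolding q m_def using n by (simp add: field_simps power2_eq_square)
  have x1: "x - 1 = (q - p\<^sup>2) / p\<^sup>2 + d * q / p\<^sup>2"
    unfolding x_def using p by (simp add: field_simps)
  have x2: "(q - p\<^sup>2) / p\<^sup>2 = (1 - p) / p + 2 * (1 - p) / (m * p\<^sup>2)"
    unfolding qpp using p m by (simp add: field_simps power2_eq_square)
  have x3: "d * q / p\<^sup>2 = 4 * (1 - p) / (p\<^sup>2 * m * (m - 2))"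
    unfolding d using qp m p by (simp add: field_simps)
  have dm: "d * m\<^sup>2 / 2 = 2 * (1 - p) / q + 4 * (1 - p) / (q * (m - 2))"
    unfolding d using qp m by (simp add: divide_simps power2_eq_square) (simp add: algebra_simps)
  have qd: "2 * m * ((q - p) / q) = 4 * (1 - p) / q"
    unfolding q' using m by simp
  \<comment> \<open>The exponent equals (m - 1)/m times \<open>S\<close>: every one of its terms
    carries a factor \<open>m - 1\<close>, replaced here by \<open>m\<close>.\<close>
  define S where "S = d * m\<^sup>2 / 2 - 2 * m * ((q - p) / q) + 2 * (x - 1)"
  have "S = 2 * (1 - p) * (1 / p - 1 / q) + 4 * (1 - p) / (q * (m - 2)) + 4 * (1 - p) / (m * p\<^sup>2)
      + 8 * (1 - p) / (p\<^sup>2 * m * (m - 2))"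
    unfolding S_def dm qd x1 x2 x3 by (simp add: algebra_simps diff_divide_distrib)
  also have "\<dots> \<le> 4 / (m * p\<^sup>2) + 12 / (m * p\<^sup>2) + 4 / (m * p\<^sup>2) + 8 / (m * p\<^sup>2)"
  proof (intro add_mono)
    have "1 / p - 1 / q = (q - p) / (p * q)"
      using p qp by (simp add: field_simps)
    also have "\<dots> \<le> (2 / m) / (p * p)"
      using p qp m unfolding q'(1) by (intro frac_le mult_left_mono divide_right_mono) auto
    finally have "(1 - p) * (1 / p - 1 / q) \<le> 1 * ((2 / m) / (p * p))"
      using p m qp by (intro mult_mono) (auto simp: field_simps)
    then have "2 * ((1 - p) * (1 / p - 1 / q)) \<le> 2 * (2 / (m * p\<^sup>2))"
      by (simp add: power2_eq_square)
    also have "\<dots> = 4 / (m * p\<^sup>2)" by simp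
    finally show "2 * (1 - p) * (1 / p - 1 / q) \<le> 4 / (m * p\<^sup>2)"
      by (simp only: mult.assoc)
    have "p * p \<le> q"
      using p qp mult_left_le_one_le[of p p] by linarith
    \<comment> \<open>From \<open>m \<ge> 3\<close> follows \<open>m - 2 \<ge> m / 3\<close>; this
      loss turns the 4 into 12.\<close>
    then have "m / 3 * p\<^sup>2 \<le> (m - 2) * q"
      using m p unfolding power2_eq_square by (intro mult_mono) auto
    then have "4 * (1 - p) / (q * (m - 2)) \<le> 4 / (m / 3 * p\<^sup>2)"
      using m p by (intro frac_le) (auto simp: mult.commute)
    then show "4 * (1 - p) / (q * (m - 2)) \<le> 12 / (m * p\<^sup>2)" by simp
    show "4 * (1 - p) / (m * p\<^sup>2) \<le> 4 / (m * p\<^sup>2)"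
      using m p by (intro divide_right_mono) auto
    have "m * p\<^sup>2 * 1 \<le> m * p\<^sup>2 * (m - 2)"
      using m by (intro mult_left_mono) auto
    then show "8 * (1 - p) / (p\<^sup>2 * m * (m - 2)) \<le> 8 / (m * p\<^sup>2)"
      using m p by (intro frac_le) (auto simp: mult_ac)
  qed
  also have "\<dots> = 28 / (m * p\<^sup>2)"
    by (simp flip: add_divide_distrib)
  finally have S: "S \<le> 28 / (m * p\<^sup>2)" .
  have "d * (m * (m - 1) / 2) - 2 * (m - 1) * ((q - p) / q) + 2 * (x - 1) / m * (m - 1) = (m - 1) / m * S"
    unfolding S_def using m by (simp add: field_simps power2_eq_square)
  also have "\<dots> \<le> (m - 1) / m * (28 / (m * p\<^sup>2))"
    using S m by (intro mult_left_mono) auto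
  also have "\<dots> \<le> 1 * (28 / (m * p\<^sup>2))"
    using m p by (intro mult_right_mono) auto
  finally show ?thesis by (simp add: m_def)
qed

lemma prod_if_power_card:
  fixes c :: "'b :: comm_monoid_mult"
  assumes "finite K" "H \<subseteq> K"
  shows "(\<Prod>e\<in>K. if e \<in> H then c else 1) = c ^ card H"
  using assms by (simp add: prod.If_cases Int_absorb1 Collect_mem_eq)

text \<open>Squaring the average over one tree introduces a second, independent tree; sums over
  graphs can then be carried out for each pair of trees.\<close>

lemma tree_avg_square:
  "(tree_avg n u)\<^sup>2 / c = tree_avg n (\<lambda>H. tree_avg n (\<lambda>H'. u H * u H' / c))"
proof -
  have "tree_avg n (\<lambda>H'. u H * u H' / c) = tree_avg n u / c * u H" for H
    using tree_avg_cmult[of n "u H / c" u] by (simp add: mult_ac)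
  then show ?thesis
    using tree_avg_cmult[of n "tree_avg n u / c" u] by (simp add: power2_eq_square mult_ac)
qed

lemma pmf_planted_tree_avg:
  assumes "0 \<le> p" "p \<le> 1" "G \<subseteq> complete_edges n" "n \<ge> 1"
  shows "pmf (planted_tree n p) G =
    tree_avg n (\<lambda>H. edge_law (complete_edges n) (\<lambda>e. if e \<in> H then 1 else p) G)"
  using pmf_planted_tree[OF assms] by (simp add: tree_avg_def)

lemma sum_pmf_planted_tree:
  assumes "0 \<le> p" "p \<le> 1" "n \<ge> 1"
  shows "(\<Sum>G\<in>Pow (complete_edges n). pmf (planted_tree n p) G) = 1"
  using assms
  by (simp add: pmf_planted_tree_avg tree_avg_const sum_edge_law finite_complete_edges
      flip: tree_avg_sum)

lemma sum_pmf_erdos_renyi: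
  assumes "0 \<le> q" "q \<le> 1"
  shows "(\<Sum>G\<in>Pow (complete_edges n). pmf (erdos_renyi n q) G) = 1"
  using assms by (simp add: pmf_erdos_renyi sum_edge_law finite_complete_edges)

text \<open>For fixed trees the sum over graphs is a product over edges whose factor depends only on
  how many of the two trees contain the edge. Both trees have n - 1 edges, so the size of their
  intersection is all that varies.\<close>

lemma planted_chi_square_le:
  fixes p q :: real
  assumes n: "n \<ge> 3" and p: "0 < p" "p < 1" and q: "q = p + 2 * (1 - p) / real n"
  shows "(\<Sum>G\<in>Pow (complete_edges n). (pmf (planted_tree n p) G)\<^sup>2 / pmf (erdos_renyi n q) G)
           \<le> exp (28 / (real n * p\<^sup>2))"
proof -
  let ?K = "complete_edges n"
  let ?a = "\<lambda>H e. if e \<in> H then 1 else p"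
  let ?N = "card ?K"
  \<comment> \<open>The factors are \<open>1 + d\<close> for an edge in neither tree,
    \<open>p / q = (1 + d) * r\<close> in exactly one, and
    \<open>1 / q = (1 + d) * r\<^sup>2 * x\<close> in both. Thus \<open>r\<close> is the correction
    for lying in a tree and \<open>x\<close> the one for being shared.\<close>
  define d where "d = (q - p)\<^sup>2 / (q * (1 - q))"
  define x where "x = (1 + d) * q / p\<^sup>2"
  define r where "r = p / q / (1 + d)"
  have qp: "q \<ge> p" using p n unfolding q by auto
  have q0: "q > 0" using qp p by linarith
  have "1 - q = (1 - p) * (real n - 2) / real n"
    using n unfolding q by (auto simp: field_simps)
  moreover have "(1 - p) * (real n - 2) / real n > 0"
    using n p by (intro divide_pos_pos mult_pos_pos) auto
  ultimately have q1: "q < 1" by linarith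
  have d: "d \<ge> 0" unfolding d_def using q0 q1 by simp
  have "p * p \<le> 1 * q"
    using p qp by (intro mult_mono) auto
  then have "p\<^sup>2 \<le> q"
    by (simp add: power2_eq_square)
  then have "p\<^sup>2 * 1 \<le> q * (1 + d)"
    using d q0 by (intro mult_mono) auto
  then have x: "x \<ge> 1"
    unfolding x_def using p by (simp add: field_simps)
  have r0: "r \<ge> 0" unfolding r_def using p q0 d by simp
  have factor: "?a H e * ?a H' e / q + (1 - ?a H e) * (1 - ?a H' e) / (1 - q) =
      (1 + d) * ((if e \<in> H then r else 1) * ((if e \<in> H' then r else 1) * (if e \<in> H' \<inter> H then x else 1)))"
    for H H' e
  proof -
    have d1: "1 + d \<noteq> 0"
      using d by linarith
    have rx: "r * x = 1 / p"
      unfolding r_def x_def using d1 p q0 by (simp add: power2_eq_square)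
    have 1: "p / q = (1 + d) * r"
      unfolding r_def using d1 by simp
    then have 2: "1 / q = (1 + d) * (r * (r * x))"
      using p unfolding mult.assoc[symmetric] 1[symmetric] unfolding mult.assoc rx by simp
    have "p * p / q + (1 - p) * (1 - p) / (1 - q) =
        (p * p * (1 - q) + (1 - p) * (1 - p) * q) / (q * (1 - q))"
      using q0 q1 by (simp add: add_frac_eq)
    also have "p * p * (1 - q) + (1 - p) * (1 - p) * q = q * (1 - q) + (q - p)\<^sup>2"
      by (simp add: power2_eq_square algebra_simps)
    also have "(q * (1 - q) + (q - p)\<^sup>2) / (q * (1 - q)) = 1 + d"
      unfolding d_def using q0 q1 by (simp add: add_divide_distrib)
    finally have "p * p / q + (1 - p) * (1 - p) / (1 - q) = 1 + d" .
    with 1 2 show ?thesis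
      by (cases "e \<in> H"; cases "e \<in> H'") simp_all
  qed
  define C where "C = (1 + d) ^ ?N * (r ^ (n - 1)) ^ 2"
  have C0: "C \<ge> 0" unfolding C_def using d by simp
  have pair: "(\<Sum>G\<in>Pow ?K. edge_law ?K (?a H) G * edge_law ?K (?a H') G / edge_law ?K (\<lambda>_. q) G) =
      C * x ^ card (H' \<inter> H)"
    if "H \<in> spanning_trees n" "H' \<in> spanning_trees n" for H H'
  proof -
    have "H \<subseteq> ?K" "H' \<subseteq> ?K" "H' \<inter> H \<subseteq> ?K"
      using spanning_treeD(1) that by auto
    then show ?thesis
      unfolding sum_edge_law_products[OF finite_complete_edges] factor prod.distrib C_def
      using card_spanning_tree[OF that(1)] card_spanning_tree[OF that(2)]
      by (simp add: prod_if_power_card[OF finite_complete_edges] power2_eq_square del: Int_iff)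
  qed
  have "(\<Sum>G\<in>Pow ?K. (pmf (planted_tree n p) G)\<^sup>2 / pmf (erdos_renyi n q) G) =
      (\<Sum>G\<in>Pow ?K. tree_avg n (\<lambda>H. tree_avg n (\<lambda>H'.
         edge_law ?K (?a H) G * edge_law ?K (?a H') G / edge_law ?K (\<lambda>_. q) G)))"
    using p q0 q1 n
    by (intro sum.cong refl) (simp add: pmf_planted_tree_avg pmf_erdos_renyi tree_avg_square)
  also have "\<dots> = tree_avg n (\<lambda>H. tree_avg n (\<lambda>H'.
      \<Sum>G\<in>Pow ?K. edge_law ?K (?a H) G * edge_law ?K (?a H') G / edge_law ?K (\<lambda>_. q) G))"
    by (simp only: tree_avg_sum)
  also have "\<dots> = tree_avg n (\<lambda>H. C * tree_avg n (\<lambda>H'. x ^ card (H' \<inter> H)))"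
    unfolding tree_avg_cmult[symmetric] by (intro tree_avg_cong pair)
  also have "\<dots> \<le> tree_avg n (\<lambda>H. C * (1 + 2 * (x - 1) / real n) ^ (n - 1))"
  proof (intro tree_avg_mono mult_left_mono C0)
    fix H assume "H \<in> spanning_trees n"
    then show "tree_avg n (\<lambda>H'. x ^ card (H' \<inter> H)) \<le> (1 + 2 * (x - 1) / real n) ^ (n - 1)"
      using tree_avg_power_Int_le[of n H x] spanning_treeD(1) card_spanning_tree x n by force
  qed
  also have "\<dots> = (1 + d) ^ ?N * (r ^ (n - 1)) ^ 2 * (1 + 2 * (x - 1) / real n) ^ (n - 1)"
    using n by (simp add: tree_avg_const C_def)
  \<comment> \<open>Each base is at most some 1 + u and so at most exp u; for \<open>r\<close>, drop
    \<open>1 + d\<close> and write p/q as 1 - (q-p)/q.\<close>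
  also have "\<dots> \<le> exp d ^ ?N * (exp (- ((q - p) / q)) ^ (n - 1)) ^ 2 * exp (2 * (x - 1) / real n) ^ (n - 1)"
  proof (intro mult_mono power_mono)
    have "r \<le> p / q / 1"
      unfolding r_def using d p q0 by (intro divide_left_mono) auto
    also have "\<dots> = 1 + (- ((q - p) / q))"
      using q0 by (simp add: field_simps)
    also have "\<dots> \<le> exp (- ((q - p) / q))"
      by (rule exp_ge_add_one_self)
    finally show "r \<le> exp (- ((q - p) / q))" .
  qed (use d r0 x n exp_ge_add_one_self in auto)
  also have "\<dots> = exp (d * real ?N + 2 * ((real n - 1) * (- ((q - p) / q))) + (2 * (x - 1) / real n) * (real n - 1))"
  proof -
    have e: "exp u ^ (n - 1) = exp ((real n - 1) * u)" for u :: real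
      using n by (simp add: of_nat_diff flip: exp_of_nat_mult)
    have e': "exp d ^ ?N = exp (d * real ?N)"
      by (simp add: mult.commute flip: exp_of_nat_mult)
    show ?thesis
      unfolding e e' exp_double[symmetric] exp_add by (simp only: mult.commute)
  qed
  also have "d * real ?N + 2 * ((real n - 1) * (- ((q - p) / q))) + (2 * (x - 1) / real n) * (real n - 1) =
      d * real ?N - 2 * (real n - 1) * ((q - p) / q) + 2 * (x - 1) / real n * (real n - 1)"
    by (simp only: mult_minus_right mult.assoc diff_conv_add_uminus)
  also have "\<dots> \<le> 28 / (real n * p\<^sup>2)"
    using chi_square_exponent_le[OF n p q]
    unfolding d_def[symmetric] x_def[symmetric] real_card_complete_edges .
  finally show ?thesis by simp
qed

lemma tv_planted_upper:
  fixes p q :: real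
  assumes n: "n \<ge> 3" and p: "0 < p" "p \<le> 1" and q: "q = p + 2 * (1 - p) / real n"
  shows "tv_dist n (planted_tree n p) (erdos_renyi n q) \<le> sqrt (exp (28 / (real n * p\<^sup>2)) - 1) / 2"
proof (cases "p = 1")
  \<comment> \<open>Here also q = 1, so \<open>erdos_renyi n q\<close> has mass only on the complete
    graph and the division by its masses breaks down; but the two laws coincide.\<close>
  case True
  have "q = 1"
    using True q by simp
  have "(\<lambda>e. if e \<in> H then 1 else p) = (\<lambda>_. 1)" for H :: "nat set set"
    using True by auto
  then have "tv_dist n (planted_tree n p) (erdos_renyi n q) = 0"
    using True \<open>q = 1\<close> n unfolding tv_dist_def graphs_on_def
    by (simp add: pmf_planted_tree_avg pmf_erdos_renyi tree_avg_const)
  then show ?thesis by simp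
next
  case False
  with p have p1: "p < 1" by simp
  let ?K = "complete_edges n"
  let ?P = "pmf (planted_tree n p)" and ?Q = "pmf (erdos_renyi n q)"
  have "q \<ge> p" using p n unfolding q by auto
  then have q0: "q > 0" using p by linarith
  have "1 - q = (1 - p) * (real n - 2) / real n"
    using n unfolding q by (auto simp: field_simps)
  moreover have "(1 - p) * (real n - 2) / real n > 0"
    using n p1 by (intro divide_pos_pos mult_pos_pos) auto
  ultimately have q1: "q < 1" by linarith
  have "?Q G > 0" if "G \<in> Pow ?K" for G
    using that q0 q1 by (auto simp: pmf_erdos_renyi edge_law_def intro!: mult_pos_pos prod_pos)
  then have "(\<Sum>G\<in>Pow ?K. \<bar>?P G - ?Q G\<bar>)\<^sup>2 \<le> (\<Sum>G\<in>Pow ?K. (?P G)\<^sup>2 / ?Q G) - 1"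
    using p n q0 q1
    by (intro sum_abs_diff_le_chi_square sum_pmf_planted_tree sum_pmf_erdos_renyi) auto
  also have "\<dots> \<le> exp (28 / (real n * p\<^sup>2)) - 1"
    using planted_chi_square_le[OF n p(1) p1 q] by simp
  finally have "(\<Sum>G\<in>Pow ?K. \<bar>?P G - ?Q G\<bar>) \<le> sqrt (exp (28 / (real n * p\<^sup>2)) - 1)"
    by (rule real_le_rsqrt)
  then show ?thesis
    by (simp add: tv_dist_def graphs_on_def)
qed

subsection \<open>The wedge statistic\<close>

text \<open>Ordered pairs count each wedge twice, but the relation is symmetric and its sums split
  over the first edge.\<close>

definition adj_pairs :: "nat \<Rightarrow> (nat set \<times> nat set) set" where
  "adj_pairs n = {(e, f). e \<in> complete_edges n \<and> f \<in> complete_edges n \<and> e \<noteq> f \<and> e \<inter> f \<noteq> {}}"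

lemma adj_pairsE:
  assumes "(e, f) \<in> adj_pairs n"
  obtains v a b where "distinct [v, a, b]" "{v, a, b} \<subseteq> {1..n}" "e = {v, a}" "f = {v, b}"
proof -
  from assms obtain v where v: "v \<in> e" "v \<in> f" "e \<in> complete_edges n" "f \<in> complete_edges n" "e \<noteq> f"
    by (auto simp: adj_pairs_def)
  obtain a where a: "e = {v, a}"
    using v(1,3) by (auto simp: complete_edges_def card_2_iff)
  obtain b where b: "f = {v, b}"
    using v(2,4) by (auto simp: complete_edges_def card_2_iff)
  show thesis
    using that[of v a b] v a b by (auto simp: doubleton_complete_edges)
qed

lemma adj_pairs_subset: "adj_pairs n \<subseteq> complete_edges n \<times> complete_edges n"
  by (auto simp: adj_pairs_def)

lemma adj_pairs_irrefl: "(e, f) \<in> adj_pairs n \<Longrightarrow> e \<noteq> f"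
  by (simp add: adj_pairs_def)

lemma adj_pairs_sym: "(e, f) \<in> adj_pairs n \<Longrightarrow> (f, e) \<in> adj_pairs n"
  by (auto simp: adj_pairs_def)

lemma finite_adj_pairs [simp]: "finite (adj_pairs n)"
  using finite_subset[OF adj_pairs_subset] finite_complete_edges by blast

lemma finite_adj [simp]: "finite {f. (e, f) \<in> adj_pairs n}"
  by (rule finite_subset[OF _ finite_complete_edges]) (auto simp: adj_pairs_def)

lemma sum_adj_pairs:
  "(\<Sum>(e, f)\<in>adj_pairs n. g e f) = (\<Sum>e\<in>complete_edges n. \<Sum>f | (e, f) \<in> adj_pairs n. g e f)"
proof -
  have "adj_pairs n = Sigma (complete_edges n) (\<lambda>e. {f. (e, f) \<in> adj_pairs n})"
    by (auto simp: adj_pairs_def)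
  then have "(\<Sum>(e, f)\<in>adj_pairs n. g e f) =
      (\<Sum>(e, f)\<in>Sigma (complete_edges n) (\<lambda>e. {f. (e, f) \<in> adj_pairs n}). g e f)"
    by (rule arg_cong)
  also have "\<dots> = (\<Sum>e\<in>complete_edges n. \<Sum>f | (e, f) \<in> adj_pairs n. g e f)"
    by (rule sum.Sigma[symmetric]) (auto simp: finite_complete_edges)
  finally show ?thesis .
qed

lemma sum_adj_pairs_swap:
  "(\<Sum>(e, f)\<in>adj_pairs n. g e f) = (\<Sum>(e, f)\<in>adj_pairs n. g f e)"
  by (rule sum.reindex_bij_witness[of _ prod.swap prod.swap]) (auto intro: adj_pairs_sym)

lemma card_adj:
  assumes "e \<in> complete_edges n"
  shows "card {f. (e, f) \<in> adj_pairs n} = 2 * (n - 2)"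
proof -
  obtain x y where e: "e = {x, y}" "x \<noteq> y" "x \<in> {1..n}" "y \<in> {1..n}"
    using assms by (auto simp: complete_edges_def card_2_iff)
  let ?R = "{1..n} - {x, y}"
  have "{f. (e, f) \<in> adj_pairs n} = (\<lambda>z. {x, z}) ` ?R \<union> (\<lambda>z. {y, z}) ` ?R" (is "?A = ?B")
  proof
    show "?A \<subseteq> ?B"
    proof
      fix f assume "f \<in> ?A"
      then have "(e, f) \<in> adj_pairs n" by simp
      then obtain v a b where v: "distinct [v, a, b]" "{v, a, b} \<subseteq> {1..n}" "e = {v, a}" "f = {v, b}"
        by (rule adj_pairsE)
      then have "v = x \<and> a = y \<or> v = y \<and> a = x"
        using e(1) by (auto simp: doubleton_eq_iff)
      with v show "f \<in> ?B" by auto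
    qed
    show "?B \<subseteq> ?A"
      using e by (auto simp: adj_pairs_def doubleton_complete_edges doubleton_eq_iff)
  qed
  moreover have "card ((\<lambda>z. {x, z}) ` ?R) = n - 2" "card ((\<lambda>z. {y, z}) ` ?R) = n - 2"
    using e by (auto simp: card_image inj_on_def doubleton_eq_iff card_Diff_subset)
  moreover have "(\<lambda>z. {x, z}) ` ?R \<inter> (\<lambda>z. {y, z}) ` ?R = {}"
    using e(2) by (auto simp: doubleton_eq_iff)
  ultimately show ?thesis
    by (simp add: card_Un_disjoint)
qed

lemma card_adj_pairs:
  assumes "n \<ge> 2"
  shows "real (card (adj_pairs n)) = real n * (real n - 1) * (real n - 2)"
proof -
  have "real (card (adj_pairs n)) = (\<Sum>(e, f)\<in>adj_pairs n. 1)"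
    by (simp add: split_def)
  also have "\<dots> = real (card (complete_edges n)) * real (2 * (n - 2))"
    unfolding sum_adj_pairs by (simp add: card_adj)
  finally show ?thesis
    using assms by (simp add: real_card_complete_edges of_nat_diff algebra_simps)
qed

section \<open>The number of wedges in a uniform spanning tree\<close>

lemma card_edges_meeting:
  assumes "finite U" "U \<subseteq> {1..n}"
  shows "card {g \<in> complete_edges n. g \<inter> U \<noteq> {}} \<le> card U * n"
proof -
  have "{g \<in> complete_edges n. g \<inter> U \<noteq> {}} \<subseteq> (\<lambda>(u, z). {u, z}) ` (U \<times> {1..n})"
    by (auto simp: complete_edges_def card_2_iff)
  then have "card {g \<in> complete_edges n. g \<inter> U \<noteq> {}} \<le> card ((\<lambda>(u, z). {u, z}) ` (U \<times> {1..n}))"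
    using assms by (intro card_mono) auto
  also have "\<dots> \<le> card (U \<times> {1..n})"
    using assms by (intro card_image_le) auto
  finally show ?thesis
    by (simp add: card_cartesian_product)
qed

text \<open>For a tree \<open>T\<close> this is the sum of d(d-1) over its vertex degrees d.\<close>

definition wedge_sum :: "nat \<Rightarrow> nat set set \<Rightarrow> real" where
  "wedge_sum n T = (\<Sum>(e, f)\<in>adj_pairs n. of_bool (e \<in> T) * of_bool (f \<in> T))"

lemma tree_prob_adj:
  assumes "(e, f) \<in> adj_pairs n"
  shows "tree_prob n {e, f} = 3 / (real n)\<^sup>2"
  using assms by (elim adj_pairsE) (auto simp: tree_prob_wedge)

lemma tree_avg_wedge_sum:
  assumes "n \<ge> 2"
  shows "tree_avg n (wedge_sum n) = 3 * (real n - 1) * (real n - 2) / real n"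
proof -
  have "tree_avg n (wedge_sum n) = (\<Sum>(e, f)\<in>adj_pairs n. tree_avg n (\<lambda>T. of_bool ({e, f} \<subseteq> T)))"
    unfolding wedge_sum_def[abs_def] tree_avg_sum split_def
    by (simp flip: of_bool_conj)
  also have "\<dots> = (\<Sum>(e, f)\<in>adj_pairs n. 3 / (real n)\<^sup>2)"
    unfolding tree_avg_of_bool by (intro sum.cong refl) (auto simp: tree_prob_adj)
  also have "\<dots> = real (card (adj_pairs n)) * (3 / (real n)\<^sup>2)"
    by (simp add: split_def)
  finally show ?thesis
    using assms by (simp add: card_adj_pairs power2_eq_square) (simp add: algebra_simps)
qed

lemma tree_prob_insert_le':
  assumes "F \<subseteq> complete_edges n" "e \<in> complete_edges n"
  shows "tree_prob n (insert e F) \<le> (if e \<in> F then 1 else 2 / real n) * tree_prob n F"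
  using tree_prob_insert_le[OF assms] by (auto simp: insert_absorb)

lemma sum_of_bool_weights_le:
  fixes c :: real
  assumes "finite A" "c \<ge> 0"
  shows "(\<Sum>g\<in>A. if g \<in> {e, f} then 1 else c) \<le> 2 + c * real (card A)"
proof -
  have "(\<Sum>g\<in>A. if g \<in> {e, f} then 1 else c) \<le> (\<Sum>g\<in>A. of_bool (g \<in> {e, f}) + c)"
    using assms by (intro sum_mono) auto
  also have "\<dots> = real (card (A \<inter> {e, f})) + c * real (card A)"
    using assms by (simp add: sum.distrib of_bool_def sum.If_cases Int_def)
  also have "card (A \<inter> {e, f}) \<le> card {e, f}"
    by (intro card_mono) auto
  also have "card {e, f} \<le> 2"
    by (cases "e = f") auto
  finally show ?thesis by simp
qed

text \<open>Wedges that are vertex-disjoint from the given one contribute exactly 9/n^4 each. The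
  others are rare enough for the crude bound of 2/n for each new edge, on top of 3/n^2 \<le> 4/n^2
  for the given wedge.\<close>

lemma sum_tree_prob_pairs_le:
  assumes n: "n \<ge> 2" and ef: "(e, f) \<in> adj_pairs n"
  shows "(\<Sum>(g, h)\<in>adj_pairs n. tree_prob n {e, f, g, h})
     \<le> real (card (adj_pairs n)) * (9 / real n ^ 4) + 384 / (real n)\<^sup>2"
proof -
  let ?K = "complete_edges n"
  define U where "U = e \<union> f"
  define w where "w = (\<lambda>g. if g \<in> {e, f} then 1 else 2 / real n)"
  have w0: "w g \<ge> 0" for g by (simp add: w_def)
  have efK: "e \<in> ?K" "f \<in> ?K" "e \<noteq> f" using ef by (auto simp: adj_pairs_def)
  obtain v a b where vab: "distinct [v, a, b]" "{v, a, b} \<subseteq> {1..n}" "e = {v, a}" "f = {v, b}"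
    using ef by (rule adj_pairsE)
  have U: "finite U" "U \<subseteq> {1..n}" "card U = 3"
    using vab by (auto simp: U_def card_insert_if insert_commute)
  \<comment> \<open>In a wedge that touches \<open>U\<close> one of its two edges meets
    \<open>U\<close>; \<open>X g h\<close> covers the case of \<open>g\<close> and
    \<open>X h g\<close> that of \<open>h\<close>.\<close>
  define X where "X = (\<lambda>g h. of_bool (g \<inter> U \<noteq> {}) * (w g * w h))"
  have bound: "tree_prob n {e, f, g, h} \<le> 9 / real n ^ 4 + 4 / (real n)\<^sup>2 * (X g h + X h g)"
    if gh: "(g, h) \<in> adj_pairs n" for g h
  proof (cases "g \<inter> U = {} \<and> h \<inter> U = {}")
    case True
    obtain v' a' b' where vab': "distinct [v', a', b']" "{v', a', b'} \<subseteq> {1..n}" "g = {v', a'}" "h = {v', b'}"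
      using gh by (rule adj_pairsE)
    have "tree_prob n {{v, a}, {v, b}, {v', a'}, {v', b'}} = 9 / real n ^ 4"
      using vab vab' True by (intro tree_prob_disjoint_wedges) (auto simp: U_def)
    then show ?thesis
      using True by (simp add: vab vab' X_def)
  next
    case False
    have ghK: "g \<in> ?K" "h \<in> ?K" "g \<noteq> h" using gh by (auto simp: adj_pairs_def)
    have "tree_prob n (insert h (insert g {e, f})) \<le> w h * tree_prob n (insert g {e, f})"
      using tree_prob_insert_le'[of "insert g {e, f}" n h] ghK efK by (auto simp: w_def)
    also have "\<dots> \<le> w h * (w g * tree_prob n {e, f})"
      using tree_prob_insert_le'[of "{e, f}" n g] ghK efK w0
      by (intro mult_left_mono) (auto simp: w_def)
    also have "\<dots> \<le> w h * (w g * (4 / (real n)\<^sup>2))"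
      using w0 by (intro mult_left_mono) (auto simp: tree_prob_adj[OF ef] divide_right_mono)
    also have "\<dots> = 4 / (real n)\<^sup>2 * (w g * w h)"
      by simp
    also have "\<dots> \<le> 4 / (real n)\<^sup>2 * (X g h + X h g)"
      using False w0[of g] w0[of h] by (intro mult_left_mono) (auto simp: X_def mult.commute)
    finally have "tree_prob n {e, f, g, h} \<le> 4 / (real n)\<^sup>2 * (X g h + X h g)"
      by (simp add: insert_commute)
    moreover have "0 \<le> 9 / real n ^ 4" by simp
    ultimately show ?thesis by linarith
  qed
  \<comment> \<open>48 is 6 * 8. For fixed \<open>g\<close>, the weights of the adjacent edges sum
    to at most 2 + 4, the 2 allowing for \<open>e\<close> and \<open>f\<close> themselves; the at
    most 3n edges that meet \<open>U\<close> have total weight at most 2 + 6.\<close>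
  have sumX: "(\<Sum>(g, h)\<in>adj_pairs n. X g h) \<le> 48"
  proof -
    have inner: "(\<Sum>h | (g, h) \<in> adj_pairs n. w h) \<le> 6" if "g \<in> ?K" for g
    proof -
      have "(\<Sum>h | (g, h) \<in> adj_pairs n. w h) \<le> 2 + 2 / real n * real (2 * (n - 2))"
        using sum_of_bool_weights_le[of "{h. (g, h) \<in> adj_pairs n}" "2 / real n" e f]
        unfolding w_def card_adj[OF that] by simp
      also have "\<dots> \<le> 2 + 2 / real n * (2 * real n)"
        by (intro add_left_mono mult_left_mono) auto
      finally show ?thesis using n by simp
    qed
    let ?A = "{g \<in> ?K. g \<inter> U \<noteq> {}}"
    have "(\<Sum>(g, h)\<in>adj_pairs n. X g h) =
        (\<Sum>g\<in>?K. of_bool (g \<inter> U \<noteq> {}) * (w g * (\<Sum>h | (g, h) \<in> adj_pairs n. w h)))"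
      unfolding sum_adj_pairs X_def by (simp add: sum_distrib_left)
    also have "\<dots> \<le> (\<Sum>g\<in>?K. of_bool (g \<inter> U \<noteq> {}) * (w g * 6))"
      using inner w0 by (intro sum_mono mult_left_mono) auto
    also have "\<dots> = 6 * (\<Sum>g\<in>?A. w g)"
      unfolding sum_distrib_left
      by (rule sum.mono_neutral_cong_right) (auto simp: finite_complete_edges)
    finally have X: "(\<Sum>(g, h)\<in>adj_pairs n. X g h) \<le> 6 * (\<Sum>g\<in>?A. w g)" .
    have "card ?A \<le> 3 * n"
      using card_edges_meeting[OF U(1,2)] unfolding U(3) .
    then have "real (card ?A) \<le> 3 * real n"
      by linarith
    then have "2 + 2 / real n * real (card ?A) \<le> 2 + 2 / real n * (3 * real n)"
      by (intro add_left_mono mult_left_mono) auto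
    moreover have "(\<Sum>g\<in>?A. w g) \<le> 2 + 2 / real n * real (card ?A)"
      unfolding w_def by (rule sum_of_bool_weights_le) (auto simp: finite_complete_edges)
    moreover have "2 + 2 / real n * (3 * real n) = 8"
      using n by simp
    ultimately show ?thesis using X by linarith
  qed
  have "(\<Sum>(g, h)\<in>adj_pairs n. tree_prob n {e, f, g, h}) \<le>
      (\<Sum>(g, h)\<in>adj_pairs n. 9 / real n ^ 4 + 4 / (real n)\<^sup>2 * (X g h + X h g))"
    using bound by (intro sum_mono) auto
  also have "\<dots> = real (card (adj_pairs n)) * (9 / real n ^ 4) +
      4 / (real n)\<^sup>2 * ((\<Sum>(g, h)\<in>adj_pairs n. X g h) + (\<Sum>(g, h)\<in>adj_pairs n. X h g))"
    by (simp only: split_def sum.distrib sum_distrib_left[symmetric] sum_constant)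
  also have "(\<Sum>(g, h)\<in>adj_pairs n. X h g) = (\<Sum>(g, h)\<in>adj_pairs n. X g h)"
    by (rule sum_adj_pairs_swap)
  also have "4 / (real n)\<^sup>2 * ((\<Sum>(g, h)\<in>adj_pairs n. X g h) + (\<Sum>(g, h)\<in>adj_pairs n. X g h)) \<le>
      4 / (real n)\<^sup>2 * 96"
    using sumX by (intro mult_left_mono) auto
  finally show ?thesis by simp
qed

lemma tree_avg_wedge_sum_variance:
  assumes n: "n \<ge> 2"
  shows "tree_avg n (\<lambda>T. (wedge_sum n T - 3 * (real n - 1) * (real n - 2) / real n)\<^sup>2) \<le> 384 * real n"
proof -
  let ?D = "adj_pairs n"
  define c where "c = 3 * (real n - 1) * (real n - 2) / real n"
  have D: "real (card ?D) = real n * (real n - 1) * (real n - 2)"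
    using n by (rule card_adj_pairs)
  have sq: "(wedge_sum n T)\<^sup>2 = (\<Sum>(e, f)\<in>?D. \<Sum>(g, h)\<in>?D. of_bool ({e, f, g, h} \<subseteq> T))" for T
    unfolding power2_eq_square wedge_sum_def sum_product split_def
    by (intro sum.cong refl) auto
  have "tree_avg n (\<lambda>T. (wedge_sum n T)\<^sup>2) = (\<Sum>(e, f)\<in>?D. \<Sum>(g, h)\<in>?D. tree_prob n {e, f, g, h})"
    unfolding sq split_def by (simp only: tree_avg_sum tree_avg_of_bool)
  also have "\<dots> \<le> (\<Sum>(e, f)\<in>?D. real (card ?D) * (9 / real n ^ 4) + 384 / (real n)\<^sup>2)"
    using sum_tree_prob_pairs_le[OF n] by (intro sum_mono) auto
  also have "\<dots> = real (card ?D) * (real (card ?D) * (9 / real n ^ 4) + 384 / (real n)\<^sup>2)"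
    by (simp add: split_def)
  \<comment> \<open>\<open>c\<close> is the number of pairs times 3/n^2, so the disjoint wedges
    yield exactly the square of the mean.\<close>
  also have "\<dots> = c\<^sup>2 + 384 * ((real n - 1) * (real n - 2) / real n)"
    unfolding D c_def using n by (simp add: field_simps power2_eq_square power4_eq_xxxx)
  also have "(real n - 1) * (real n - 2) / real n \<le> real n * real n / real n"
    using n by (intro divide_right_mono mult_mono) auto
  finally have *: "tree_avg n (\<lambda>T. (wedge_sum n T)\<^sup>2) \<le> c\<^sup>2 + 384 * real n"
    using n by simp
  have "tree_avg n (\<lambda>T. (wedge_sum n T - c)\<^sup>2) =
      tree_avg n (\<lambda>T. (wedge_sum n T)\<^sup>2 + (- 2 * c) * wedge_sum n T + c\<^sup>2)"
    by (rule tree_avg_cong) (simp add: power2_eq_square algebra_simps)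
  also have "\<dots> = tree_avg n (\<lambda>T. (wedge_sum n T)\<^sup>2) + (- 2 * c) * tree_avg n (wedge_sum n) + c\<^sup>2"
    using n by (simp only: tree_avg_add tree_avg_cmult tree_avg_const)
  also have "\<dots> = tree_avg n (\<lambda>T. (wedge_sum n T)\<^sup>2) - c\<^sup>2"
    unfolding tree_avg_wedge_sum[OF n] c_def[symmetric] by (simp add: power2_eq_square)
  finally show ?thesis
    using * by (simp add: c_def)
qed

text \<open>The difference q - p is 1 - p times 2/n, the probability that an edge lies in the tree.
  After centring at q the tree indicator is centred at its own mean, and p survives only in a
  prefactor.\<close>

lemma planted_centring:
  fixes p q :: real
  assumes "n \<ge> 1" "q = p + 2 * (1 - p) / real n"
  shows "(if e \<in> T then 1 else p) - q = (1 - p) * (of_bool (e \<in> T) - 2 / real n)"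
  using assms by (auto simp: field_simps)

lemma sum_adj_pairs_of_bool:
  assumes "T \<in> spanning_trees n" "n \<ge> 2"
  shows "(\<Sum>(e, f)\<in>adj_pairs n. of_bool (e \<in> T)) = 2 * (real n - 1) * (real n - 2)"
proof -
  have T: "T \<subseteq> complete_edges n" "card T = n - 1"
    using spanning_treeD(1)[OF assms(1)] card_spanning_tree[OF assms(1)] .
  have "(\<Sum>(e, f)\<in>adj_pairs n. of_bool (e \<in> T) :: real) =
      (\<Sum>e\<in>complete_edges n. real (2 * (n - 2)) * of_bool (e \<in> T))"
    unfolding sum_adj_pairs by (intro sum.cong refl) (simp add: card_adj)
  also have "\<dots> = real (2 * (n - 2)) * real (card (complete_edges n \<inter> T))"
    unfolding sum_distrib_left[symmetric]
    by (simp add: of_bool_def sum.If_cases finite_complete_edges Int_def)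
  also have "complete_edges n \<inter> T = T" using T(1) by auto
  finally show ?thesis
    using assms(2) T(2) by (simp add: of_nat_diff) (simp add: algebra_simps)
qed

text \<open>After centring, the linear terms depend on \<open>T\<close> only through its number of
  edges, which is fixed; \<open>wedge_sum\<close> is all that remains random. Its mean has
  coefficient 3 against the 4 subtracted here.\<close>

lemma planted_mean_given_tree:
  fixes p q :: real
  assumes T: "T \<in> spanning_trees n" and n: "n \<ge> 2" and q: "q = p + 2 * (1 - p) / real n"
  shows "(\<Sum>(e, f)\<in>adj_pairs n. ((if e \<in> T then 1 else p) - q) * ((if f \<in> T then 1 else p) - q)) =
    (1 - p)\<^sup>2 * (wedge_sum n T - 4 * (real n - 1) * (real n - 2) / real n)"
proof -
  let ?D = "adj_pairs n"
  define c where "c = 2 / real n"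
  have n1: "n \<ge> 1" using n by simp
  have "(\<Sum>(e, f)\<in>?D. ((if e \<in> T then 1 else p) - q) * ((if f \<in> T then 1 else p) - q)) =
      (\<Sum>(e, f)\<in>?D. (1 - p)\<^sup>2 * (of_bool (e \<in> T) * of_bool (f \<in> T) - c * of_bool (e \<in> T)
         - c * of_bool (f \<in> T) + c\<^sup>2))"
    unfolding planted_centring[OF n1 q] c_def[symmetric]
    by (intro sum.cong refl) (simp add: split_def power2_eq_square algebra_simps)
  also have "\<dots> = (1 - p)\<^sup>2 * (wedge_sum n T - c * (\<Sum>(e, f)\<in>?D. of_bool (e \<in> T))
      - c * (\<Sum>(e, f)\<in>?D. of_bool (f \<in> T)) + real (card ?D) * c\<^sup>2)"
    unfolding wedge_sum_def
    by (simp only: split_def sum.distrib sum_subtractf sum_distrib_left[symmetric] sum_constant)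
  also have "(\<Sum>(e, f)\<in>?D. of_bool (f \<in> T)) = (\<Sum>(e, f)\<in>?D. of_bool (e \<in> T) :: real)"
    by (rule sum_adj_pairs_swap)
  also have "wedge_sum n T - c * (\<Sum>(e, f)\<in>?D. of_bool (e \<in> T)) - c * (\<Sum>(e, f)\<in>?D. of_bool (e \<in> T))
      + real (card ?D) * c\<^sup>2 = wedge_sum n T - 4 * (real n - 1) * (real n - 2) / real n"
    unfolding sum_adj_pairs_of_bool[OF T n] card_adj_pairs[OF n] c_def
    using n by (simp add: field_simps power2_eq_square)
  finally show ?thesis .
qed

text \<open>The number \<open>u\<close> of tree edges adjacent to \<open>e\<close> has mean
  \<open>v \<le> 4\<close> and second moment at most v + v^2 \<le> 20. As both are nonnegative, (u -
  v)^2 \<le> u^2 + 16, which gives 36.\<close>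

lemma tree_avg_linear_coefficient:
  fixes p q :: real
  assumes n: "n \<ge> 2" and p: "0 \<le> p" "p \<le> 1" and q: "q = p + 2 * (1 - p) / real n"
    and e: "e \<in> complete_edges n"
  shows "tree_avg n (\<lambda>T. (\<Sum>f | (e, f) \<in> adj_pairs n. (if f \<in> T then 1 else p) - q)\<^sup>2) \<le> 36"
proof -
  let ?A = "{f. (e, f) \<in> adj_pairs n}"
  define k where "k = real (card ?A)"
  have "k = real (2 * (n - 2))" unfolding k_def card_adj[OF e] ..
  then have k: "0 \<le> k" "k \<le> 2 * real n" by auto
  have n1: "n \<ge> 1" using n by simp
  define u where "u = (\<lambda>T :: nat set set. \<Sum>f\<in>?A. of_bool (f \<in> T) :: real)"
  define v where "v = 2 / real n * k"
  have v: "0 \<le> v" "v \<le> 4"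
    unfolding v_def using k n by (auto simp: field_simps)
  have u0: "u T \<ge> 0" for T
    unfolding u_def by (intro sum_nonneg) auto
  have "(\<Sum>f\<in>?A. (if f \<in> T then 1 else p) - q)\<^sup>2 \<le> (u T)\<^sup>2 + 16" for T
  proof -
    have "(\<Sum>f\<in>?A. (if f \<in> T then 1 else p) - q) = (1 - p) * (u T - v)"
      unfolding planted_centring[OF n1 q] sum_distrib_left[symmetric] sum_subtractf
      by (simp add: u_def v_def k_def)
    then have "(\<Sum>f\<in>?A. (if f \<in> T then 1 else p) - q)\<^sup>2 = (1 - p)\<^sup>2 * (u T - v)\<^sup>2"
      by (simp add: power_mult_distrib)
    also have "\<dots> \<le> 1 * (u T - v)\<^sup>2"
      using p by (intro mult_right_mono) (auto simp: power_le_one)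
    finally have 1: "(\<Sum>f\<in>?A. (if f \<in> T then 1 else p) - q)\<^sup>2 \<le> (u T - v)\<^sup>2" by simp
    have "(u T - v)\<^sup>2 = (u T)\<^sup>2 + v\<^sup>2 - 2 * (u T * v)"
      by (simp add: power2_eq_square algebra_simps)
    moreover have "v\<^sup>2 \<le> 4\<^sup>2"
      using v by (intro power_mono) auto
    moreover have "0 \<le> u T * v"
      using u0 v by simp
    ultimately show ?thesis using 1 by simp
  qed
  then have "tree_avg n (\<lambda>T. (\<Sum>f\<in>?A. (if f \<in> T then 1 else p) - q)\<^sup>2) \<le> tree_avg n (\<lambda>T. (u T)\<^sup>2 + 16)"
    by (intro tree_avg_mono)
  also have "\<dots> = tree_avg n (\<lambda>T. (u T)\<^sup>2) + 16"
    using n1 by (simp add: tree_avg_add tree_avg_const)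
  also have "tree_avg n (\<lambda>T. (u T)\<^sup>2) = (\<Sum>f\<in>?A. \<Sum>g\<in>?A. tree_prob n {f, g})"
  proof -
    have "(u T)\<^sup>2 = (\<Sum>f\<in>?A. \<Sum>g\<in>?A. of_bool ({f, g} \<subseteq> T))" for T
      unfolding u_def power2_eq_square sum_product by (intro sum.cong refl) auto
    then show ?thesis
      by (simp only: tree_avg_sum tree_avg_of_bool)
  qed
  also have "\<dots> \<le> (\<Sum>f\<in>?A. \<Sum>g\<in>?A. (if g = f then 2 / real n else 0) + (2 / real n)\<^sup>2)"
  proof (intro sum_mono)
    fix f g assume "f \<in> ?A" "g \<in> ?A"
    then have K: "{f, g} \<subseteq> complete_edges n" by (auto simp: adj_pairs_def)
    show "tree_prob n {f, g} \<le> (if g = f then 2 / real n else 0) + (2 / real n)\<^sup>2"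
    proof (cases "g = f")
      case True
      then show ?thesis using tree_prob_edge[of f n] K by simp
    next
      case False
      then have "card {f, g} = 2" by auto
      then show ?thesis using tree_prob_le[OF n1 K] False by (simp add: power2_eq_square)
    qed
  qed
  also have "\<dots> = (\<Sum>f\<in>?A. 2 / real n + k * (2 / real n)\<^sup>2)"
    by (intro sum.cong refl) (simp add: sum.distrib k_def)
  also have "\<dots> = v + v\<^sup>2"
    by (simp add: k_def[symmetric] v_def power2_eq_square algebra_simps)
  also have "\<dots> \<le> 4 + 4\<^sup>2"
    using v by (intro add_mono power_mono) auto
  finally show ?thesis by simp
qed

section \<open>Moments of the statistic under the two models\<close>

definition wedge_statistic :: "nat \<Rightarrow> real \<Rightarrow> nat set set \<Rightarrow> real" where
  "wedge_statistic n q G = (\<Sum>(e, f)\<in>adj_pairs n. (of_bool (e \<in> G) - q) * (of_bool (f \<in> G) - q))"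

lemma card_adj_pairs_le: "n \<ge> 2 \<Longrightarrow> real (card (adj_pairs n)) \<le> real n ^ 3"
proof -
  assume n: "n \<ge> 2"
  have "real n * (real n - 1) * (real n - 2) \<le> real n * real n * real n"
    using n by (intro mult_mono) auto
  then show ?thesis
    using n by (simp add: card_adj_pairs power3_eq_cube)
qed

text \<open>Here all edge probabilities equal the centring value, so the mean and the linear part
  vanish and only the quadratic part of \<open>edge_exp_pair_sum_variance\<close> is left.\<close>

lemma erdos_renyi_wedge_statistic:
  assumes n: "n \<ge> 2" and q: "0 \<le> q" "q \<le> 1"
  shows "(\<Sum>G\<in>Pow (complete_edges n). pmf (erdos_renyi n q) G * (wedge_statistic n q G)\<^sup>2)
           \<le> 4 * real n ^ 3 * q\<^sup>2"
proof -
  let ?K = "complete_edges n"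
  have "q * (1 - q) \<le> q * 1"
    using q by (intro mult_left_mono) auto
  then have "edge_exp ?K (\<lambda>_. q) (\<lambda>G. (wedge_statistic n q G - (\<Sum>(e, f)\<in>adj_pairs n. (q - q) * (q - q)))\<^sup>2)
      \<le> 8 * q * (\<Sum>e\<in>?K. (\<Sum>f | (e, f) \<in> adj_pairs n. q - q)\<^sup>2) + 4 * real (card (adj_pairs n)) * q\<^sup>2"
    unfolding wedge_statistic_def using q
    by (intro edge_exp_pair_sum_variance[where a = "\<lambda>_. q"] finite_complete_edges adj_pairs_subset)
      (auto intro: adj_pairs_sym dest: adj_pairs_irrefl)
  then have "edge_exp ?K (\<lambda>_. q) (\<lambda>G. (wedge_statistic n q G)\<^sup>2) \<le> 4 * real (card (adj_pairs n)) * q\<^sup>2"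
    by (simp add: split_def)
  also have "\<dots> \<le> 4 * real n ^ 3 * q\<^sup>2"
    using card_adj_pairs_le[OF n] by (intro mult_right_mono mult_left_mono) auto
  finally show ?thesis
    using q by (simp add: edge_exp_def pmf_erdos_renyi)
qed

text \<open>Split the deviation at the conditional mean \<open>M H\<close> given the tree. Given
  \<open>H\<close>, an edge has variance 0 on the tree and p(1-p) off it, and averaging the linear
  coefficients over trees gives the term p n^2. The deviation of \<open>M H\<close> from \<mu> is
  (1-p)^2 times that of \<open>wedge_sum\<close> from its mean. The factors 288 = 2 * 8 * 18, 8 = 2
  * 4 and 768 = 2 * 384 come from squaring the split sum.\<close>

lemma planted_wedge_statistic:
  fixes p q :: real
  assumes n: "n \<ge> 2" and p: "0 \<le> p" "p \<le> 1" and q: "q = p + 2 * (1 - p) / real n"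
  defines "\<mu> \<equiv> - (1 - p)\<^sup>2 * (real n - 1) * (real n - 2) / real n"
  shows "(\<Sum>G\<in>Pow (complete_edges n). pmf (planted_tree n p) G * (wedge_statistic n q G - \<mu>)\<^sup>2)
           \<le> 288 * p * (real n)\<^sup>2 + 8 * real n ^ 3 * p\<^sup>2 + 768 * real n"
proof -
  let ?K = "complete_edges n" and ?D = "adj_pairs n"
  let ?W = "wedge_statistic n q"
  let ?a = "\<lambda>H e. if e \<in> H then 1 else p"
  define M where "M = (\<lambda>H. \<Sum>(e, f)\<in>?D. (?a H e - q) * (?a H f - q))"
  define L where "L = (\<lambda>H e. \<Sum>f | (e, f) \<in> ?D. ?a H f - q)"
  define c where "c = 3 * (real n - 1) * (real n - 2) / real n"
  have fin: "finite ?K" by (rule finite_complete_edges)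
  have n1: "n \<ge> 1" using n by simp
  have p2: "p * (1 - p) \<le> p * 1"
    using p by (intro mult_left_mono) auto
  have M\<mu>: "(M H - \<mu>)\<^sup>2 \<le> (wedge_sum n H - c)\<^sup>2" if "H \<in> spanning_trees n" for H
  proof -
    have "M H - \<mu> = (1 - p)\<^sup>2 * (wedge_sum n H - c)"
      unfolding M_def planted_mean_given_tree[OF that n q] \<mu>_def c_def
      using n by (simp add: field_simps)
    then have "(M H - \<mu>)\<^sup>2 = ((1 - p)\<^sup>2)\<^sup>2 * (wedge_sum n H - c)\<^sup>2"
      by (simp add: power_mult_distrib)
    also have "\<dots> \<le> 1 * (wedge_sum n H - c)\<^sup>2"
      using p by (intro mult_right_mono) (auto simp: power_le_one)
    finally show ?thesis by simp
  qed
  have cond: "edge_exp ?K (?a H) (\<lambda>G. (?W G - \<mu>)\<^sup>2) \<le>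
      2 * (8 * p * (\<Sum>e\<in>?K. (L H e)\<^sup>2) + 4 * real (card ?D) * p\<^sup>2) + 2 * (wedge_sum n H - c)\<^sup>2"
    if H: "H \<in> spanning_trees n" for H
  proof -
    have "(?W G - \<mu>)\<^sup>2 \<le> 2 * (?W G - M H)\<^sup>2 + 2 * (M H - \<mu>)\<^sup>2" for G
      using zero_le_power2[of "(?W G - M H) - (M H - \<mu>)"] by (simp add: power2_eq_square algebra_simps)
    then have "edge_exp ?K (?a H) (\<lambda>G. (?W G - \<mu>)\<^sup>2) \<le>
        edge_exp ?K (?a H) (\<lambda>G. 2 * (?W G - M H)\<^sup>2 + 2 * (M H - \<mu>)\<^sup>2)"
      using p by (intro edge_exp_mono) auto
    also have "\<dots> = 2 * edge_exp ?K (?a H) (\<lambda>G. (?W G - M H)\<^sup>2) + 2 * (M H - \<mu>)\<^sup>2"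
      by (simp only: edge_exp_add edge_exp_cmult edge_exp_const[OF fin])
    also have "edge_exp ?K (?a H) (\<lambda>G. (?W G - M H)\<^sup>2) \<le>
        8 * p * (\<Sum>e\<in>?K. (L H e)\<^sup>2) + 4 * real (card ?D) * p\<^sup>2"
      unfolding wedge_statistic_def M_def L_def
      using p p2
      by (intro edge_exp_pair_sum_variance fin adj_pairs_subset)
        (auto intro: adj_pairs_sym dest: adj_pairs_irrefl)
    also note M\<mu>[OF H]
    finally show ?thesis by simp
  qed
  have "(\<Sum>G\<in>Pow ?K. pmf (planted_tree n p) G * (?W G - \<mu>)\<^sup>2) =
      (\<Sum>G\<in>Pow ?K. tree_avg n (\<lambda>H. (?W G - \<mu>)\<^sup>2 * edge_law ?K (?a H) G))"
    unfolding tree_avg_cmult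
    using p n1 by (intro sum.cong refl) (simp add: pmf_planted_tree_avg)
  also have "\<dots> = tree_avg n (\<lambda>H. edge_exp ?K (?a H) (\<lambda>G. (?W G - \<mu>)\<^sup>2))"
    unfolding tree_avg_sum[symmetric] edge_exp_def by (simp only: mult.commute)
  also have "\<dots> \<le> tree_avg n (\<lambda>H.
      2 * (8 * p * (\<Sum>e\<in>?K. (L H e)\<^sup>2) + 4 * real (card ?D) * p\<^sup>2) + 2 * (wedge_sum n H - c)\<^sup>2)"
    by (intro tree_avg_mono cond)
  also have "\<dots> = 2 * (8 * p * (\<Sum>e\<in>?K. tree_avg n (\<lambda>H. (L H e)\<^sup>2)) + 4 * real (card ?D) * p\<^sup>2)
      + 2 * tree_avg n (\<lambda>H. (wedge_sum n H - c)\<^sup>2)"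
    by (simp only: tree_avg_add tree_avg_cmult tree_avg_sum tree_avg_const[OF n1])
  also have "\<dots> \<le> 2 * (8 * p * (\<Sum>e\<in>?K. 36) + 4 * real n ^ 3 * p\<^sup>2) + 2 * (384 * real n)"
    unfolding L_def c_def using p card_adj_pairs_le[OF n]
    by (intro add_mono mult_left_mono mult_right_mono sum_mono
        tree_avg_linear_coefficient[OF n p q] tree_avg_wedge_sum_variance[OF n]) auto
  also have "(\<Sum>e\<in>?K. 36 :: real) = 18 * (real n * (real n - 1))"
    by (simp add: real_card_complete_edges)
  also have "2 * (8 * p * (18 * (real n * (real n - 1))) + 4 * real n ^ 3 * p\<^sup>2) + 2 * (384 * real n) \<le>
      2 * (8 * p * (18 * (real n * real n)) + 4 * real n ^ 3 * p\<^sup>2) + 2 * (384 * real n)"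
    using p by (intro add_mono mult_left_mono order_refl) auto
  finally show ?thesis
    by (simp add: power2_eq_square algebra_simps)
qed

text \<open>No value of \<open>f\<close> is close to both 0 and \<mu>: f^2 + (f - \<mu>)^2 is at
  least \<mu>^2/2. Weighting this with min(P, Q), whose total is one minus the distance, gives a
  second-moment bound without fixing a threshold for a test.\<close>

lemma half_sum_abs_diff_ge:
  fixes P Q f :: "'a \<Rightarrow> real"
  assumes "\<And>x. x \<in> A \<Longrightarrow> P x \<ge> 0" "\<And>x. x \<in> A \<Longrightarrow> Q x \<ge> 0" "sum P A = 1" "sum Q A = 1" "\<mu> \<noteq> 0"
  shows "1 - 2 * ((\<Sum>x\<in>A. Q x * (f x)\<^sup>2) + (\<Sum>x\<in>A. P x * (f x - \<mu>)\<^sup>2)) / \<mu>\<^sup>2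
           \<le> (\<Sum>x\<in>A. \<bar>P x - Q x\<bar>) / 2"
proof -
  have \<mu>: "\<mu>\<^sup>2 > 0" using assms(5) by simp
  have pt: "P x + Q x - 4 * (Q x * (f x)\<^sup>2 + P x * (f x - \<mu>)\<^sup>2) / \<mu>\<^sup>2 \<le> \<bar>P x - Q x\<bar>" if "x \<in> A" for x
  proof -
    let ?m = "min (P x) (Q x)"
    have m: "0 \<le> ?m" using assms(1,2) that by simp
    have "\<mu>\<^sup>2 / 2 \<le> (f x)\<^sup>2 + (f x - \<mu>)\<^sup>2"
      using zero_le_power2[of "2 * f x - \<mu>"] by (simp add: power2_eq_square algebra_simps)
    then have "?m * (\<mu>\<^sup>2 / 2) \<le> ?m * ((f x)\<^sup>2 + (f x - \<mu>)\<^sup>2)"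
      using m by (rule mult_left_mono)
    also have "\<dots> = ?m * (f x)\<^sup>2 + ?m * (f x - \<mu>)\<^sup>2"
      by (rule distrib_left)
    also have "\<dots> \<le> Q x * (f x)\<^sup>2 + P x * (f x - \<mu>)\<^sup>2"
      by (intro add_mono mult_right_mono) auto
    finally have "2 * ?m \<le> 4 * (Q x * (f x)\<^sup>2 + P x * (f x - \<mu>)\<^sup>2) / \<mu>\<^sup>2"
      using \<mu> by (simp add: pos_le_divide_eq)
    moreover have "P x + Q x - 2 * ?m = \<bar>P x - Q x\<bar>"
      by (simp add: min_def)
    ultimately show ?thesis by linarith
  qed
  have "(\<Sum>x\<in>A. P x + Q x - 4 * (Q x * (f x)\<^sup>2 + P x * (f x - \<mu>)\<^sup>2) / \<mu>\<^sup>2) \<le> (\<Sum>x\<in>A. \<bar>P x - Q x\<bar>)"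
    by (intro sum_mono pt)
  moreover have "(\<Sum>x\<in>A. P x + Q x - 4 * (Q x * (f x)\<^sup>2 + P x * (f x - \<mu>)\<^sup>2) / \<mu>\<^sup>2) =
      2 - 4 * ((\<Sum>x\<in>A. Q x * (f x)\<^sup>2) + (\<Sum>x\<in>A. P x * (f x - \<mu>)\<^sup>2)) / \<mu>\<^sup>2"
    by (simp only: sum_subtractf sum.distrib sum_divide_distrib[symmetric] sum_distrib_left[symmetric]
        assms(3,4))
  ultimately show ?thesis
    by (simp add: field_simps)
qed

section \<open>Explicit lower bound on the distance, and the limits\<close>

lemma planted_parameter_bounds:
  fixes p q :: real
  assumes "n \<ge> 2" "0 \<le> p" "p \<le> 1" "q = p + 2 * (1 - p) / real n"
  shows "0 \<le> q" "q \<le> 1" "q \<le> p + 2 / real n"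
proof -
  have "2 * (1 - p) / real n \<le> 2 * 1 / real n"
    using assms by (intro divide_right_mono) auto
  then show "q \<le> p + 2 / real n" using assms(4) by simp
  have "2 * (1 - p) / real n \<le> 2 * (1 - p) / 2"
    using assms by (intro divide_left_mono) auto
  also have "\<dots> = 1 - p" by simp
  finally show "q \<le> 1" unfolding assms(4) by linarith
  show "0 \<le> q" using assms by simp
qed

lemma tv_dist_nonneg: "tv_dist n P Q \<ge> 0"
  unfolding tv_dist_def by (intro divide_nonneg_pos sum_nonneg) auto

lemma tv_planted_le_1:
  assumes "n \<ge> 1" "0 \<le> p" "p \<le> 1" "0 \<le> q" "q \<le> 1"
  shows "tv_dist n (planted_tree n p) (erdos_renyi n q) \<le> 1"
proof -
  let ?K = "complete_edges n"
  have "(\<Sum>G\<in>Pow ?K. \<bar>pmf (planted_tree n p) G - pmf (erdos_renyi n q) G\<bar>) \<le>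
      (\<Sum>G\<in>Pow ?K. pmf (planted_tree n p) G + pmf (erdos_renyi n q) G)"
    by (intro sum_mono) (simp add: abs_le_iff)
  also have "\<dots> = 2"
    unfolding sum.distrib using assms by (simp add: sum_pmf_planted_tree sum_pmf_erdos_renyi)
  finally show ?thesis
    by (simp add: tv_dist_def graphs_on_def)
qed

text \<open>Dividing both second moments by \<mu>^2 \<ge> n^2/64 produces 128 = 2 * 64. Everything
  is expressed in x = p sqrt n, using n p^2 = x^2 and p \<le> x; the term n q^2 \<le> 2 x^2 + 8/n
  accounts for 16 = 8 + 8 and 800 = 768 + 32.\<close>

lemma tv_planted_lower:
  fixes p q :: real
  assumes n: "n \<ge> 6" and p: "0 \<le> p" "p \<le> 1 / 2" and q: "q = p + 2 * (1 - p) / real n"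
  shows "1 - 128 * (16 * (p * sqrt (real n))\<^sup>2 + 288 * (p * sqrt (real n)) + 800 / real n)
           \<le> tv_dist n (planted_tree n p) (erdos_renyi n q)"
proof -
  let ?K = "complete_edges n"
  define m where "m = real n"
  define x where "x = p * sqrt m"
  define \<mu> where "\<mu> = - (1 - p)\<^sup>2 * (m - 1) * (m - 2) / m"
  define V where "V = (\<Sum>G\<in>Pow ?K. pmf (erdos_renyi n q) G * (wedge_statistic n q G)\<^sup>2) +
      (\<Sum>G\<in>Pow ?K. pmf (planted_tree n p) G * (wedge_statistic n q G - \<mu>)\<^sup>2)"
  have m: "m \<ge> 6" using n by (simp add: m_def)
  have p1: "p \<le> 1" using p by simp
  have n2: "n \<ge> 2" "n \<ge> 1" using n by auto
  note qb = planted_parameter_bounds[OF n2(1) p(1) p1 q]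
  have x2: "m * p\<^sup>2 = x\<^sup>2" unfolding x_def using m by (simp add: power_mult_distrib)
  have "p * 1 \<le> p * sqrt m"
    using p m by (intro mult_left_mono) auto
  then have px: "p \<le> x" by (simp add: x_def)
  \<comment> \<open>This lower bound on the size of \<mu> is where \<open>p \<le> 1 / 2\<close> and
    \<open>n \<ge> 6\<close> enter, one for each factor.\<close>
  have "1 / 4 * (m / 2) \<le> (1 - p)\<^sup>2 * ((m - 1) * (m - 2) / m)"
  proof (rule mult_mono)
    have "(1 / 2)\<^sup>2 \<le> (1 - p)\<^sup>2"
      using p by (intro power_mono) auto
    then show "1 / 4 \<le> (1 - p)\<^sup>2" by (simp add: power2_eq_square)
    have "6 * m \<le> m * m" using m by (intro mult_right_mono) auto
    moreover have "(m - 1) * (m - 2) = m * m - 3 * m + 2"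
      by (simp add: algebra_simps)
    moreover have "m / 2 * m = m * m / 2" by simp
    ultimately have "m / 2 * m \<le> (m - 1) * (m - 2)" using m by linarith
    then show "m / 2 \<le> (m - 1) * (m - 2) / m"
      using m by (simp add: pos_le_divide_eq)
  qed (use m in auto)
  then have mu: "m / 8 \<le> - \<mu>"
    unfolding \<mu>_def by (simp add: mult.assoc)
  then have "(m / 8)\<^sup>2 \<le> (- \<mu>)\<^sup>2"
    using m by (intro power_mono) auto
  then have mu2: "m\<^sup>2 / 64 \<le> \<mu>\<^sup>2"
    by (simp add: power_divide)
  have mu0: "\<mu> \<noteq> 0" using mu m by auto
  have "V \<le> 4 * m ^ 3 * q\<^sup>2 + (288 * p * m\<^sup>2 + 8 * m ^ 3 * p\<^sup>2 + 768 * m)"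
    unfolding V_def \<mu>_def m_def
    by (intro add_mono erdos_renyi_wedge_statistic planted_wedge_statistic n2 qb p p1 q)
  also have "\<dots> = m\<^sup>2 * (4 * (m * q\<^sup>2) + 288 * p + 8 * x\<^sup>2 + 768 / m)"
    unfolding x2[symmetric] using m by (simp add: field_simps power2_eq_square power3_eq_cube)
  also have "\<dots> \<le> m\<^sup>2 * (4 * (2 * x\<^sup>2 + 8 / m) + 288 * x + 8 * x\<^sup>2 + 768 / m)"
  proof (intro mult_left_mono add_mono order_refl px)
    have "q\<^sup>2 \<le> (p + 2 / m)\<^sup>2"
      using qb by (intro power_mono) (auto simp: m_def)
    also have "\<dots> \<le> 2 * p\<^sup>2 + 2 * (2 / m)\<^sup>2"
      using zero_le_power2[of "p - 2 / m"] by (simp add: power2_eq_square algebra_simps)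
    finally have "m * q\<^sup>2 \<le> m * (2 * p\<^sup>2 + 2 * (2 / m)\<^sup>2)"
      using m by (intro mult_left_mono) auto
    also have "\<dots> = 2 * x\<^sup>2 + 8 / m"
      unfolding x2[symmetric] using m by (simp add: field_simps power2_eq_square)
    finally show "m * q\<^sup>2 \<le> 2 * x\<^sup>2 + 8 / m" .
  qed auto
  also have "\<dots> = m\<^sup>2 * (16 * x\<^sup>2 + 288 * x + 800 / m)"
    by (simp add: algebra_simps add_divide_distrib[symmetric])
  finally have V: "V \<le> m\<^sup>2 * (16 * x\<^sup>2 + 288 * x + 800 / m)" .
  have "2 * V / \<mu>\<^sup>2 \<le> 2 * (m\<^sup>2 * (16 * x\<^sup>2 + 288 * x + 800 / m)) / (m\<^sup>2 / 64)"
  proof (rule frac_le)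
    show "0 \<le> 2 * (m\<^sup>2 * (16 * x\<^sup>2 + 288 * x + 800 / m))"
      using m p px by (intro mult_nonneg_nonneg add_nonneg_nonneg) auto
  qed (use V mu2 m in auto)
  also have "\<dots> = 128 * (16 * x\<^sup>2 + 288 * x + 800 / m)"
    using m by simp
  finally have "1 - 128 * (16 * x\<^sup>2 + 288 * x + 800 / m) \<le> 1 - 2 * V / \<mu>\<^sup>2"
    by simp
  also have "\<dots> \<le> (\<Sum>G\<in>Pow ?K. \<bar>pmf (planted_tree n p) G - pmf (erdos_renyi n q) G\<bar>) / 2"
    unfolding V_def
    by (intro half_sum_abs_diff_ge sum_pmf_planted_tree sum_pmf_erdos_renyi pmf_nonneg mu0 n2 p p1 qb)
  finally show ?thesis
    by (simp add: tv_dist_def graphs_on_def x_def m_def)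
qed

theorem theorem4p1:
  fixes p q :: "nat \<Rightarrow> real"
  assumes p: "\<And>n. n \<ge> 2 \<Longrightarrow> 0 \<le> p n \<and> p n \<le> 1"
    and q: "\<And>n. n \<ge> 2 \<Longrightarrow> q n = p n + 2 * (1 - p n) / real n"
  shows "(filterlim (\<lambda>n. p n * sqrt (real n)) at_top sequentially \<longrightarrow>
            (\<lambda>n. tv_dist n (planted_tree n (p n)) (erdos_renyi n (q n))) \<longlonglongrightarrow> 0) \<and>
         ((\<lambda>n. p n * sqrt (real n)) \<longlonglongrightarrow> 0 \<longrightarrow>
            (\<lambda>n. tv_dist n (planted_tree n (p n)) (erdos_renyi n (q n))) \<longlonglongrightarrow> 1)"
proof (intro conjI impI)
  let ?tv = "\<lambda>n. tv_dist n (planted_tree n (p n)) (erdos_renyi n (q n))"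
  let ?x = "\<lambda>n. p n * sqrt (real n)"
  {
    assume lim: "filterlim ?x at_top sequentially"
    have "filterlim (\<lambda>n. (?x n)\<^sup>2) at_top sequentially"
      using lim by (intro filterlim_pow_at_top) auto
    then have "(\<lambda>n. 28 / (?x n)\<^sup>2) \<longlonglongrightarrow> 0"
      by (intro tendsto_divide_0[OF tendsto_const] filterlim_at_top_imp_at_infinity)
    then have "(\<lambda>n. sqrt (exp (28 / (?x n)\<^sup>2) - 1) / 2) \<longlonglongrightarrow> sqrt (exp 0 - 1) / 2"
      by (intro tendsto_intros) auto
    then have up: "(\<lambda>n. sqrt (exp (28 / (?x n)\<^sup>2) - 1) / 2) \<longlonglongrightarrow> 0"
      by simp
    have "\<forall>\<^sub>F n in sequentially. ?x n > 0"
      using lim by (simp add: filterlim_at_top_dense)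
    then have le: "\<forall>\<^sub>F n in sequentially. ?tv n \<le> sqrt (exp (28 / (?x n)\<^sup>2) - 1) / 2"
      using eventually_ge_at_top[of 3]
    proof eventually_elim
      case (elim n)
      have n2: "n \<ge> 2" using elim(2) by simp
      have "p n > 0"
        using elim p[OF n2] by (auto simp: zero_less_mult_iff)
      then have "?tv n \<le> sqrt (exp (28 / (real n * (p n)\<^sup>2)) - 1) / 2"
        using elim(2) p[OF n2] q[OF n2] by (intro tv_planted_upper) auto
      then show ?case
        by (simp add: power_mult_distrib mult.commute)
    qed
    show "?tv \<longlonglongrightarrow> 0"
      by (rule tendsto_sandwich[OF _ le tendsto_const up]) (simp add: tv_dist_nonneg)
  }
  {
    assume lim: "?x \<longlonglongrightarrow> 0"
    have "(\<lambda>n. 1 - 128 * (16 * (?x n)\<^sup>2 + 288 * ?x n + 800 / real n)) \<longlonglongrightarrow>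
        1 - 128 * (16 * 0\<^sup>2 + 288 * 0 + 0)"
      by (intro tendsto_intros lim lim_const_over_n)
    then have low: "(\<lambda>n. 1 - 128 * (16 * (?x n)\<^sup>2 + 288 * ?x n + 800 / real n)) \<longlonglongrightarrow> 1"
      by simp
    have "\<forall>\<^sub>F n in sequentially. ?x n < 1 / 2"
      using lim by (rule order_tendstoD) simp
    then have ge: "\<forall>\<^sub>F n in sequentially.
        1 - 128 * (16 * (?x n)\<^sup>2 + 288 * ?x n + 800 / real n) \<le> ?tv n"
      using eventually_ge_at_top[of 6]
    proof eventually_elim
      case (elim n)
      have n2: "n \<ge> 2" using elim(2) by simp
      have "p n * 1 \<le> ?x n"
        using p[OF n2] elim(2) by (intro mult_left_mono) auto
      then have "p n \<le> 1 / 2"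
        using elim(1) by simp
      then show ?case
        using elim(2) p[OF n2] q[OF n2] by (intro tv_planted_lower) auto
    qed
    have le: "\<forall>\<^sub>F n in sequentially. ?tv n \<le> 1"
      using eventually_ge_at_top[of 2]
    proof eventually_elim
      case (elim n)
      then show ?case
        using p[OF elim] planted_parameter_bounds[OF elim _ _ q[OF elim]]
        by (intro tv_planted_le_1) auto
    qed
    show "?tv \<longlonglongrightarrow> 1"
      by (rule tendsto_sandwich[OF ge le low tendsto_const])
  }
qed

end
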